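(* Let $R$ be a commutative ring and let $S=R[X_1,\ldots,X_n]$ be a polynomial ring. The relative Krull dimension of the extension $S/R$ is equal to $n$. Hence, if the Krull dimension of $R$ is $\le r$, the Krull dimension of $S$ is $\le r+n+rn$. Furthermore, if the Krull dimension of $S$ is $\le r+n$, the Krull dimension of $R$ is $\le r$.
   Context: For subsets $J,U$ of a ring, $\langle J\rangle$ is the ideal generated by $J$ and $\mathcal{M}(U)$ the multiplicative monoid (containing $1$) generated by $U$. An idealistic chain of length $\ell$ in $S$ is a list $((J_0,U_0),\ldots,(J_\ell,U_\ell))$ of pairs of subsets of $S$; it collapses if there exist $j_i\in\langle J_i\rangle$, $u_i\in\mathcal{M}(U_i)$ with $u_0(u_1(\cdots(u_\ell+j_\ell)+\cdots)+j_1)+j_0=0$. For $R\subseteq S$, the chain collapses above $R$ if there exist $a_1,\ldots,a_k\in R$ such that for every pair $(H,H')$ of complementary subsets of $\{1,\ldots,k\}$ the chain $(\{a_h\}_{h\in H}\cup J_0,U_0),(J_1,U_1),\ldots,(J_\ell,U_\ell\cup\{a_h\}_{h\in H'})$ collapses (in $S$). The elementary chain associated with $(x_1,\ldots,x_\ell)$ is $((\{0\},\{x_1\}),(\{x_1\},\{x_2\}),\ldots,(\{x_{\ell-1}\},\{x_\ell\}),(\{x_\ell\},\{1\}))$; for $\ell=0$ it is $((\{0\},\{1\}))$. The relative Krull dimension of $S/R$ is $\le\ell-1$ iff the elementary chain of every sequence of length $\ell$ in $S$ collapses above $R$; it is $\ge\ell$ iff there is a sequence of length $\ell$ in $S$ whose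 elementary chain does not collapse above $R$ (meaning: for any $a_1,\ldots,a_k\in R$ some pair $(H,H')$ of complementary subsets yields a chain which does not collapse, in the sense of the inequality relation given on the ring, by default the negation of equality). It is equal to $\ell$ if it is both $\le\ell$ and $\ge\ell$. (Absolute) Krull dimension: a ring $A$ has dimension $\le-1$ iff $1=0$ in $A$; for $\ell\ge1$ it has dimension $\le\ell-1$ iff the elementary chain of every sequence of length $\ell$ in $A$ collapses in $A$, i.e. for all $x_1,\ldots,x_\ell\in A$ there are $a_i\in A$, $m_i\in\mathbb{N}$ with $x_1^{m_1}(\cdots(x_\ell^{m_\ell}(1+a_\ell x_\ell)+\cdots)+a_1x_1)=0$.
   Formalization: Equality of the relative Krull dimension of S/R with n is stated only for R with 1 ≠ 0, because in the trivial ring every chain collapses and the dimension is not ≥ n; the bound ≤ n and both statements on the Krull dimensions of R and S hold for every commutative ring. *)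

theory Defs
  imports "HOL-Algebra.Indexed_Polynomials"
begin

section \<open>Idealistic chains and collapse\<close>

inductive_set monoid_generated :: "('a, 'm) monoid_scheme \<Rightarrow> 'a set \<Rightarrow> 'a set"
  for S and U where
    one: "\<one>\<^bsub>S\<^esub> \<in> monoid_generated S U"
  | incl: "u \<in> U \<Longrightarrow> u \<in> monoid_generated S U"
  | prod: "\<lbrakk> u \<in> monoid_generated S U; v \<in> monoid_generated S U \<rbrakk>
      \<Longrightarrow> u \<otimes>\<^bsub>S\<^esub> v \<in> monoid_generated S U"

text \<open>A chain of length \<open>l\<close> is a list of \<open>l + 1\<close> pairs.\<close>

type_synonym 'a ichain = "('a set \<times> 'a set) list"

text \<open>The fold starts from \<open>1\<close>, so that its innermost factor is
  \<open>u l \<otimes> 1 \<oplus> j l = u l \<oplus> j l\<close>.\<close>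

definition collapses :: "('a, 'm) ring_scheme \<Rightarrow> 'a ichain \<Rightarrow> bool" where
  "collapses S C \<longleftrightarrow>
     (\<exists>u j. (\<forall>i < length C. j i \<in> Idl\<^bsub>S\<^esub> (fst (C ! i)) \<and> u i \<in> monoid_generated S (snd (C ! i))) \<and>
            foldr (\<lambda>i v. u i \<otimes>\<^bsub>S\<^esub> v \<oplus>\<^bsub>S\<^esub> j i) [0..<length C] \<one>\<^bsub>S\<^esub> = \<zero>\<^bsub>S\<^esub>)"

definition adjoin_first :: "'a set \<Rightarrow> 'a ichain \<Rightarrow> 'a ichain" where
  "adjoin_first A C = (A \<union> fst (hd C), snd (hd C)) # tl C"

definition adjoin_last :: "'a set \<Rightarrow> 'a ichain \<Rightarrow> 'a ichain" where
  "adjoin_last B C = butlast C @ [(fst (last C), snd (last C) \<union> B)]"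

text \<open>\<open>K\<close> is the underlying set of the base ring, viewed inside \<open>S\<close>; the family
  \<open>a\<^sub>1, \<dots>, a\<^sub>k\<close> is the list \<open>as\<close>, indexed from 0. For a chain of length 0 both
  adjunctions affect its single pair.\<close>

definition collapses_above :: "('a, 'm) ring_scheme \<Rightarrow> 'a set \<Rightarrow> 'a ichain \<Rightarrow> bool" where
  "collapses_above S K C \<longleftrightarrow>
     (\<exists>as. set as \<subseteq> K \<and>
           (\<forall>H H'. H \<union> H' = {..<length as} \<and> H \<inter> H' = {} \<longrightarrow>
              collapses S (adjoin_last ((!) as ` H') (adjoin_first ((!) as ` H) C))))"

definition elementary_chain :: "('a, 'm) ring_scheme \<Rightarrow> 'a list \<Rightarrow> 'a ichain" where
  "elementary_chain S xs =
     zip ({\<zero>\<^bsub>S\<^esub>} # map (\<lambda>x. {x}) xs) (map (\<lambda>x. {x}) xs @ [{\<one>\<^bsub>S\<^esub>}])"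

section \<open>Krull dimension\<close>

text \<open>Upper bounds are integers \<open>d \<ge> -1\<close>; both relations are false for \<open>d < -1\<close>.\<close>

definition krull_dim_le :: "('a, 'm) ring_scheme \<Rightarrow> int \<Rightarrow> bool" where
  "krull_dim_le A d \<longleftrightarrow>
     (d = -1 \<and> \<one>\<^bsub>A\<^esub> = \<zero>\<^bsub>A\<^esub>) \<or>
     (d \<ge> 0 \<and> (\<forall>xs. set xs \<subseteq> carrier A \<and> int (length xs) = d + 1 \<longrightarrow>
                     collapses A (elementary_chain A xs)))"

definition rel_krull_dim_le :: "('a, 'm) ring_scheme \<Rightarrow> 'a set \<Rightarrow> int \<Rightarrow> bool" where
  "rel_krull_dim_le S K d \<longleftrightarrow>
     d \<ge> -1 \<and> (\<forall>xs. set xs \<subseteq> carrier S \<and> int (length xs) = d + 1 \<longrightarrow>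
                    collapses_above S K (elementary_chain S xs))"

text \<open>In the trivial ring every chain collapses, so no lower bound ever holds there.\<close>

definition rel_krull_dim_ge :: "('a, 'm) ring_scheme \<Rightarrow> 'a set \<Rightarrow> nat \<Rightarrow> bool" where
  "rel_krull_dim_ge S K l \<longleftrightarrow>
     (\<exists>xs. set xs \<subseteq> carrier S \<and> length xs = l \<and>
           \<not> collapses_above S K (elementary_chain S xs))"

definition rel_krull_dim_eq :: "('a, 'm) ring_scheme \<Rightarrow> 'a set \<Rightarrow> nat \<Rightarrow> bool" where
  "rel_krull_dim_eq S K l \<longleftrightarrow> rel_krull_dim_le S K (int l) \<and> rel_krull_dim_ge S K l"

section \<open>The polynomial ring in \<open>n\<close> variables\<close>

text \<open>The library has the set of polynomials with variables indexed by \<open>{1..n}\<close> (functions from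
  monomials, i.e. multisets of indices, to coefficients) but no ring structure on it. The product
  is the Cauchy product over all factorisations of the monomial \<open>m\<close>.\<close>

definition mpoly_ring :: "('a, 'm) ring_scheme \<Rightarrow> nat \<Rightarrow> (nat multiset \<Rightarrow> 'a) ring" where
  "mpoly_ring R n =
     \<lparr> carrier = ring.indexed_pset R {1..n} (carrier R),
       monoid.mult = (\<lambda>p q m. \<Oplus>\<^bsub>R\<^esub>k \<in> {k. k \<subseteq># m}. p k \<otimes>\<^bsub>R\<^esub> q (m - k)),
       one = ring.indexed_const R \<one>\<^bsub>R\<^esub>,
       zero = ring.indexed_const R \<zero>\<^bsub>R\<^esub>,
       add = ring.indexed_padd R \<rparr>"

definition mpoly_consts :: "('a, 'm) ring_scheme \<Rightarrow> (nat multiset \<Rightarrow> 'a) set" where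
  "mpoly_consts R = ring.indexed_const R ` carrier R"

end

theory Submission
  imports Defs
begin

text \<open>
  For the upper bound on the relative dimension, take \<open>n + 1\<close> polynomials in \<open>n\<close> variables. There
  are more products of their powers than monomials occurring in these products, so a homogeneous
  linear system over \<open>R\<close> yields an algebraic relation. Fraction-free elimination involves only
  finitely many elements of \<open>R\<close>; once each of them is declared zero or invertible, the
  lexicographically smallest exponent with invertible coefficient turns the relation into a collapse.
  For the lower bound, and for descending from the polynomial ring to \<open>R\<close>, read off the coefficient
  of \<open>X\<^sub>1\<^bsup>m\<^esup> \<cdots> X\<^sub>n\<^bsup>k\<^esup>\<close>, with the outer exponents of a collapse of
  \<open>X\<^sub>1, \<dots>, X\<^sub>n, a\<^sub>1, \<dots>, a\<^sub>l\<close>: it is a collapse of \<open>a\<^sub>1, \<dots>, a\<^sub>l\<close>.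
  For the absolute bound, a sequence of length \<open>(n + 1) (r + 1)\<close> which does not collapse gives, by
  Zorn's lemma, a strict chain of primes of that length. If every \<open>(n + 1)\<close>-st contraction to \<open>R\<close>
  grows, these contractions contradict the dimension of \<open>R\<close>; otherwise \<open>n + 2\<close> consecutive primes
  with the same contraction contradict the relative dimension.
\<close>

section \<open>Collapse of elementary chains\<close>

text \<open>The family adjoined in a collapse above \<open>R\<close> has to be fixed before it is
  known which of its members count as zero and which as invertible, whereas the pivots of an
  elimination depend on exactly this. Hence all branches are computed in advance, and the finite set
  of all pivots and coefficients that they may produce is adjoined; every coefficient is then
  decided by every partition. A coefficient that is not invertible matters only below the leading
  exponent: terms with larger exponents are absorbed by the nested expression whatever their
  coefficients are, while smaller ones have to vanish modulo the constants declared zero. The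
  counting succeeds because n + 1 polynomials with exponents below D have D^(n+1) products, but the
  monomials in these products number only O(D^n). The bound r + n + rn is (n + 1)(r + 1) - 1: a
  chain with (n + 1)(r + 1) strict steps splits into r + 1 blocks of n + 1 steps. If every block
  grows in \<open>R\<close>, there are r + 2 distinct primes of \<open>R\<close>, one more than
  dimension r admits.\<close>

text \<open>The elementary chain of \<open>xs\<close> collapses iff \<open>0\<close> lies in \<open>boundary_set R {1} xs\<close>; elements
  adjoined to the last monoid of the chain enlarge \<open>B\<close>.\<close>

primrec boundary_set :: "('a, 'm) ring_scheme \<Rightarrow> 'a set \<Rightarrow> 'a list \<Rightarrow> 'a set" where
  "boundary_set R B [] = B"
| "boundary_set R B (x # xs) =
     {x [^]\<^bsub>R\<^esub> m \<otimes>\<^bsub>R\<^esub> (t \<oplus>\<^bsub>R\<^esub> a \<otimes>\<^bsub>R\<^esub> x) | (m::nat) t a. t \<in> boundary_set R B xs \<and> a \<in> carrier R}"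

text \<open>Recursive form of the nested expression, with all admissible choices of \<open>u\<close>
  and \<open>j\<close> at once; the empty chain gives 1, the start value of the fold. It opens the
  way to induction on the list.\<close>

primrec chain_values :: "('a, 'm) ring_scheme \<Rightarrow> 'a ichain \<Rightarrow> 'a set" where
  "chain_values S [] = {\<one>\<^bsub>S\<^esub>}"
| "chain_values S (p # C) = {u \<otimes>\<^bsub>S\<^esub> v \<oplus>\<^bsub>S\<^esub> j | u v j.
     u \<in> monoid_generated S (snd p) \<and> v \<in> chain_values S C \<and> j \<in> Idl\<^bsub>S\<^esub> (fst p)}"

lemma chain_values_iff:
  "z \<in> chain_values S C \<longleftrightarrow>
     (\<exists>u j. (\<forall>i < length C. j i \<in> Idl\<^bsub>S\<^esub> (fst (C ! i)) \<and> u i \<in> monoid_generated S (snd (C ! i))) \<and>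
            foldr (\<lambda>i v. u i \<otimes>\<^bsub>S\<^esub> v \<oplus>\<^bsub>S\<^esub> j i) [0..<length C] \<one>\<^bsub>S\<^esub> = z)"
proof (induction C arbitrary: z)
  case Nil
  then show ?case by auto
next
  case (Cons p C)
  have upt: "[0..<length (p # C)] = 0 # map Suc [0..<length C]"
    by (simp add: upt_conv_Cons map_Suc_upt del: upt_Suc)
  show ?case
  proof
    assume "z \<in> chain_values S (p # C)"
    then obtain u0 v j0 where z: "z = u0 \<otimes>\<^bsub>S\<^esub> v \<oplus>\<^bsub>S\<^esub> j0" "u0 \<in> monoid_generated S (snd p)"
      "v \<in> chain_values S C" "j0 \<in> Idl\<^bsub>S\<^esub> (fst p)"
      by auto
    from Cons.IH[THEN iffD1, OF z(3)] obtain u j where uj: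
      "\<forall>i < length C. j i \<in> Idl\<^bsub>S\<^esub> (fst (C ! i)) \<and> u i \<in> monoid_generated S (snd (C ! i))"
      "foldr (\<lambda>i v. u i \<otimes>\<^bsub>S\<^esub> v \<oplus>\<^bsub>S\<^esub> j i) [0..<length C] \<one>\<^bsub>S\<^esub> = v"
      by blast
    \<comment> \<open>\<open>case_nat\<close> prepends the choice made for the head pair; in the
      converse direction, composition with \<open>Suc\<close> drops it again.\<close>
    have "\<forall>i < length (p # C). case_nat j0 j i \<in> Idl\<^bsub>S\<^esub> (fst ((p # C) ! i)) \<and>
        case_nat u0 u i \<in> monoid_generated S (snd ((p # C) ! i))"
      using uj(1) z(2,4) by (auto split: nat.split)
    moreover have "foldr (\<lambda>i v. case_nat u0 u i \<otimes>\<^bsub>S\<^esub> v \<oplus>\<^bsub>S\<^esub> case_nat j0 j i) [0..<length (p # C)] \<one>\<^bsub>S\<^esub> = z"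
      using uj(2) z(1) unfolding upt by (simp add: foldr_map o_def)
    ultimately show "\<exists>u j. (\<forall>i < length (p # C). j i \<in> Idl\<^bsub>S\<^esub> (fst ((p # C) ! i)) \<and>
        u i \<in> monoid_generated S (snd ((p # C) ! i))) \<and>
        foldr (\<lambda>i v. u i \<otimes>\<^bsub>S\<^esub> v \<oplus>\<^bsub>S\<^esub> j i) [0..<length (p # C)] \<one>\<^bsub>S\<^esub> = z"
      by blast
  next
    assume "\<exists>u j. (\<forall>i < length (p # C). j i \<in> Idl\<^bsub>S\<^esub> (fst ((p # C) ! i)) \<and>
        u i \<in> monoid_generated S (snd ((p # C) ! i))) \<and>
        foldr (\<lambda>i v. u i \<otimes>\<^bsub>S\<^esub> v \<oplus>\<^bsub>S\<^esub> j i) [0..<length (p # C)] \<one>\<^bsub>S\<^esub> = z"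
    then obtain u j where uj: "\<And>i. i < length (p # C) \<Longrightarrow> j i \<in> Idl\<^bsub>S\<^esub> (fst ((p # C) ! i)) \<and>
        u i \<in> monoid_generated S (snd ((p # C) ! i))"
      and z: "foldr (\<lambda>i v. u i \<otimes>\<^bsub>S\<^esub> v \<oplus>\<^bsub>S\<^esub> j i) [0..<length (p # C)] \<one>\<^bsub>S\<^esub> = z"
      by blast
    define v where "v = foldr (\<lambda>i v. u (Suc i) \<otimes>\<^bsub>S\<^esub> v \<oplus>\<^bsub>S\<^esub> j (Suc i)) [0..<length C] \<one>\<^bsub>S\<^esub>"
    have "v \<in> chain_values S C"
      using uj[of "Suc _"] v_def
      by (intro Cons.IH[THEN iffD2] exI[of _ "u \<circ> Suc"] exI[of _ "j \<circ> Suc"]) auto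
    moreover have "z = u 0 \<otimes>\<^bsub>S\<^esub> v \<oplus>\<^bsub>S\<^esub> j 0"
      using z unfolding upt by (simp add: foldr_map o_def v_def)
    ultimately show "z \<in> chain_values S (p # C)"
      using uj[of 0] by auto
  qed
qed

lemma collapses_iff_zero_in_chain_values: "collapses S C \<longleftrightarrow> \<zero>\<^bsub>S\<^esub> \<in> chain_values S C"
  unfolding chain_values_iff collapses_def ..

context cring
begin

lemma genideal_singleton: "a \<in> carrier R \<Longrightarrow> Idl {a} = {r \<otimes> a | r. r \<in> carrier R}"
  by (simp add: cgenideal_eq_genideal[symmetric] cgenideal_def)

lemma monoid_generated_closed: "U \<subseteq> carrier R \<Longrightarrow> monoid_generated R U \<subseteq> carrier R"
proof
  fix x assume "x \<in> monoid_generated R U" "U \<subseteq> carrier R"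
  then show "x \<in> carrier R" by induction auto
qed

lemma monoid_generated_singleton:
  assumes "a \<in> carrier R"
  shows "monoid_generated R {a} = {a [^] m | m::nat. True}"
proof (intro equalityI subsetI)
  fix x assume "x \<in> monoid_generated R {a}"
  then show "x \<in> {a [^] m | m::nat. True}"
  proof induction
    case one
    show ?case using nat_pow_0[of a] by (metis (mono_tags, lifting) mem_Collect_eq)
  next
    case (incl u)
    then show ?case using nat_pow_eone[OF assms] by (metis (mono_tags, lifting) mem_Collect_eq singletonD)
  next
    case (prod u v)
    then show ?case using nat_pow_mult[OF assms] by blast
  qed
next
  fix x assume "x \<in> {a [^] m | m::nat. True}"
  then obtain m :: nat where "x = a [^] m" by blast
  moreover have "a [^] m \<in> monoid_generated R {a}"
    by (induction m) (auto intro: monoid_generated.intros)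
  ultimately show "x \<in> monoid_generated R {a}" by simp
qed

lemma boundary_set_closed:
  assumes "B \<subseteq> carrier R" "set xs \<subseteq> carrier R"
  shows "boundary_set R B xs \<subseteq> carrier R"
  using assms(2)
proof (induction xs)
  case (Cons x xs)
  then have "boundary_set R B xs \<subseteq> carrier R" "x \<in> carrier R" by simp_all
  then show ?case unfolding boundary_set.simps by fast
qed (simp add: assms(1))

lemma boundary_set_ConsI:
  fixes m :: nat
  assumes "t \<in> boundary_set R B xs" "a \<in> carrier R"
  shows "x [^] m \<otimes> (t \<oplus> a \<otimes> x) \<in> boundary_set R B (x # xs)"
  unfolding boundary_set.simps using assms by blast

text \<open>The first ideal is an arbitrary \<open>J\<close> because removing the pair
  \<open>(J, {x})\<close> leaves a chain of the same shape that starts with \<open>{x}\<close>. Its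
  values have the form t + r x; a power of x in front of them gives the boundary set of
  \<open>x # xs\<close>, and only the ideal of \<open>J\<close> stays outside.\<close>

lemma chain_values_elementary:
  assumes "J \<subseteq> carrier R" "V \<subseteq> carrier R" "set xs \<subseteq> carrier R"
  shows "chain_values R (adjoin_last V (zip (J # map (\<lambda>x. {x}) xs) (map (\<lambda>x. {x}) xs @ [{\<one>}]))) =
    {t \<oplus> j | t j. t \<in> boundary_set R (monoid_generated R (insert \<one> V)) xs \<and> j \<in> Idl J}"
  using assms
proof (induction xs arbitrary: J)
  case Nil
  let ?M = "monoid_generated R (insert \<one> V)"
  have "?M \<subseteq> carrier R"
    using Nil by (intro monoid_generated_closed) auto
  then have one: "t \<otimes> \<one> = t" if "t \<in> ?M" for t
    using that by auto
  have "adjoin_last V (zip (J # map (\<lambda>x. {x}) []) (map (\<lambda>x. {x}) [] @ [{\<one>}])) = [(J, insert \<one> V)]"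
    by (simp add: adjoin_last_def)
  moreover have "chain_values R [(J, insert \<one> V)] = {t \<oplus> j | t j. t \<in> ?M \<and> j \<in> Idl J}"
    unfolding chain_values.simps fst_conv snd_conv using one by (intro equalityI subsetI; clarsimp; metis)
  ultimately show ?case by simp
next
  case (Cons x xs)
  let ?T = "boundary_set R (monoid_generated R (insert \<one> V)) xs"
  let ?D = "zip ({x} # map (\<lambda>x. {x}) xs) (map (\<lambda>x. {x}) xs @ [{\<one>}])"
  have D: "?D \<noteq> []" by (cases xs) auto
  have x: "x \<in> carrier R" using Cons by simp
  have T: "?T \<subseteq> carrier R"
    using Cons by (intro boundary_set_closed monoid_generated_closed) auto
  have adj: "adjoin_last V ((J, {x}) # D) = (J, {x}) # adjoin_last V D" if "D \<noteq> []" for D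
    using that by (simp add: adjoin_last_def)
  have eq: "adjoin_last V (zip (J # map (\<lambda>x. {x}) (x # xs)) (map (\<lambda>x. {x}) (x # xs) @ [{\<one>}]))
      = (J, {x}) # adjoin_last V ?D"
    by (simp only: list.map append_Cons zip_Cons_Cons adj[OF D])
  have IH: "chain_values R (adjoin_last V ?D) = {t \<oplus> j | t j. t \<in> ?T \<and> j \<in> Idl {x}}"
    by (rule Cons.IH) (use Cons.prems in auto)
  show ?case
  proof (intro equalityI subsetI)
    fix z assume "z \<in> chain_values R (adjoin_last V (zip (J # map (\<lambda>x. {x}) (x # xs))
      (map (\<lambda>x. {x}) (x # xs) @ [{\<one>}])))"
    then obtain u v j where z: "z = u \<otimes> v \<oplus> j" "u \<in> monoid_generated R {x}"
      "v \<in> chain_values R (adjoin_last V ?D)" "j \<in> Idl J"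
      unfolding eq chain_values.simps fst_conv snd_conv by blast
    from z(2) obtain m where u: "u = x [^] (m::nat)" unfolding monoid_generated_singleton[OF x] by blast
    from z(3) obtain t r where v: "v = t \<oplus> r \<otimes> x" "t \<in> ?T" "r \<in> carrier R"
      unfolding IH genideal_singleton[OF x] by blast
    show "z \<in> {t \<oplus> j | t j. t \<in> boundary_set R (monoid_generated R (insert \<one> V)) (x # xs) \<and> j \<in> Idl J}"
      unfolding z(1) u v(1) using boundary_set_ConsI[OF v(2,3)] z(4) by blast
  next
    fix z assume "z \<in> {t \<oplus> j | t j. t \<in> boundary_set R (monoid_generated R (insert \<one> V)) (x # xs) \<and> j \<in> Idl J}"
    then obtain m t r j where z: "z = x [^] (m::nat) \<otimes> (t \<oplus> r \<otimes> x) \<oplus> j" "t \<in> ?T" "r \<in> carrier R" "j \<in> Idl J"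
      unfolding boundary_set.simps by blast
    have "t \<oplus> r \<otimes> x \<in> chain_values R (adjoin_last V ?D)"
      unfolding IH genideal_singleton[OF x] using z(2,3) by blast
    moreover have "x [^] m \<in> monoid_generated R {x}" unfolding monoid_generated_singleton[OF x] by blast
    ultimately show "z \<in> chain_values R (adjoin_last V (zip (J # map (\<lambda>x. {x}) (x # xs))
      (map (\<lambda>x. {x}) (x # xs) @ [{\<one>}])))"
      unfolding eq chain_values.simps fst_conv snd_conv using z(1,4) by blast
  qed
qed

lemma adjoin_first_elementary:
  "adjoin_first A (elementary_chain R xs) = zip ((A \<union> {\<zero>}) # map (\<lambda>x. {x}) xs) (map (\<lambda>x. {x}) xs @ [{\<one>}])"
  by (cases xs) (auto simp: adjoin_first_def elementary_chain_def)

lemma collapses_adjoined_elementary_iff: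
  assumes "A \<subseteq> carrier R" "V \<subseteq> carrier R" "set xs \<subseteq> carrier R"
  shows "collapses R (adjoin_last V (adjoin_first A (elementary_chain R xs))) \<longleftrightarrow>
    (\<exists>t \<in> boundary_set R (monoid_generated R (insert \<one> V)) xs. \<exists>j \<in> Idl (A \<union> {\<zero>}). t \<oplus> j = \<zero>)"
proof -
  have A0: "A \<union> {\<zero>} \<subseteq> carrier R" using assms by simp
  have "collapses R (adjoin_last V (adjoin_first A (elementary_chain R xs))) \<longleftrightarrow>
      (\<exists>t j. \<zero> = t \<oplus> j \<and> t \<in> boundary_set R (monoid_generated R (insert \<one> V)) xs \<and> j \<in> Idl (A \<union> {\<zero>}))"
    unfolding collapses_iff_zero_in_chain_values adjoin_first_elementary
      chain_values_elementary[OF A0 assms(2,3)] mem_Collect_eq ..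
  then show ?thesis unfolding Bex_def eq_commute[of \<zero>] by blast
qed

lemma collapses_elementary_iff:
  assumes "set xs \<subseteq> carrier R"
  shows "collapses R (elementary_chain R xs) \<longleftrightarrow> \<zero> \<in> boundary_set R {\<one>} xs"
proof -
  have "elementary_chain R xs = adjoin_last {} (adjoin_first {} (elementary_chain R xs))"
  proof -
    have "elementary_chain R xs \<noteq> []" by (cases xs) (auto simp: elementary_chain_def)
    then show ?thesis by (simp add: adjoin_last_def adjoin_first_def)
  qed
  moreover have "boundary_set R {\<one>} xs \<subseteq> carrier R"
    using assms by (intro boundary_set_closed) auto
  moreover have "monoid_generated R {\<one>} = {\<one>}"
    by (simp add: monoid_generated_singleton)
  ultimately show ?thesis
    using collapses_adjoined_elementary_iff[of "{}" "{}" xs] assms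
    by (auto simp: genideal_zero subset_iff)
qed

section \<open>Chains of prime ideals\<close>

lemma ideal_adjoin:
  assumes P: "ideal P R" and x: "x \<in> carrier R"
  obtains J where "ideal J R" "P \<subseteq> J" "x \<in> J"
    "\<And>y. y \<in> J \<Longrightarrow> \<exists>p\<in>P. \<exists>r\<in>carrier R. y = p \<oplus> r \<otimes> x"
proof
  let ?J = "set_add R P (PIdl x)"
  note ix = cgenideal_ideal[OF x]
  show "ideal ?J R" by (rule add_ideals[OF P ix])
  have "P \<union> PIdl x \<subseteq> ?J"
    unfolding union_genideal[OF P ix, symmetric]
    using ideal.Icarr[OF P] ideal.Icarr[OF ix] by (intro genideal_self) blast
  then show "P \<subseteq> ?J" "x \<in> ?J" using cgenideal_self[OF x] by auto
  show "\<exists>p\<in>P. \<exists>r\<in>carrier R. y = p \<oplus> r \<otimes> x" if "y \<in> ?J" for y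
    using that by (auto simp: set_add_def' cgenideal_def)
qed

text \<open>An ideal maximal among those that contain \<open>I\<close> and miss \<open>M\<close> is
  prime: if a and b lie outside it, adjoining either one yields an element of \<open>M\<close>, and
  the product of these two elements lies in \<open>M\<close>, but also in the ideal once ab
  does.\<close>

lemma exists_primeideal_disjoint:
  assumes I: "ideal I R" and M: "M \<subseteq> carrier R" "\<one> \<in> M"
    and mult: "\<And>a b. a \<in> M \<Longrightarrow> b \<in> M \<Longrightarrow> a \<otimes> b \<in> M"
    and disj: "I \<inter> M = {}"
  obtains P where "primeideal P R" "I \<subseteq> P" "P \<inter> M = {}"
proof -
  define F where "F = {J. ideal J R \<and> I \<subseteq> J \<and> J \<inter> M = {}}"
  have "\<exists>P\<in>F. \<forall>J\<in>F. P \<subseteq> J \<longrightarrow> J = P"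
  proof (rule subset_Zorn_nonempty)
    show "F \<noteq> {}" using I disj by (auto simp: F_def)
    fix C assume C: "C \<noteq> {}" "subset.chain F C"
    then have sub: "C \<subseteq> F" by (simp add: subset.chain_def)
    have "subset.chain {I. ideal I R} C"
      using C by (auto simp: subset.chain_def F_def)
    then have "ideal (\<Union>C) R"
      using chain_Union_is_ideal[of C] C(1) by simp
    moreover have "I \<subseteq> \<Union>C" using sub C(1) unfolding F_def by fast
    moreover have "\<Union>C \<inter> M = {}" using sub unfolding F_def by fast
    ultimately show "\<Union>C \<in> F" by (simp add: F_def)
  qed
  then obtain P where P: "P \<in> F" and max: "\<And>J. J \<in> F \<Longrightarrow> P \<subseteq> J \<Longrightarrow> J = P" by blast
  interpret P: ideal P R using P by (simp add: F_def)
  have meets: "\<exists>p\<in>P. \<exists>r\<in>carrier R. p \<oplus> r \<otimes> a \<in> M" if a: "a \<in> carrier R" "a \<notin> P" for a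
  proof -
    obtain J where J: "ideal J R" "P \<subseteq> J" "a \<in> J"
      "\<And>y. y \<in> J \<Longrightarrow> \<exists>p\<in>P. \<exists>r\<in>carrier R. y = p \<oplus> r \<otimes> a"
      using ideal_adjoin[OF P.is_ideal a(1)] by blast
    then have "J \<notin> F" using max a by auto
    then have "J \<inter> M \<noteq> {}" using J(1,2) P by (auto simp: F_def)
    then show ?thesis using J(4) by blast
  qed
  have "primeideal P R"
  proof (rule primeidealI)
    show "ideal P R" "cring R" by (unfold_locales)
    show "carrier R \<noteq> P" using P M by (auto simp: F_def)
    fix a b assume ab: "a \<in> carrier R" "b \<in> carrier R" "a \<otimes> b \<in> P"
    show "a \<in> P \<or> b \<in> P"
    proof (rule ccontr)
      assume "\<not> (a \<in> P \<or> b \<in> P)"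
      then obtain p r q s where h: "p \<in> P" "r \<in> carrier R" "p \<oplus> r \<otimes> a \<in> M"
        "q \<in> P" "s \<in> carrier R" "q \<oplus> s \<otimes> b \<in> M"
        using meets ab by metis
      note c = P.Icarr[OF h(1)] P.Icarr[OF h(4)]
      have "(p \<oplus> r \<otimes> a) \<otimes> (q \<oplus> s \<otimes> b) = p \<otimes> (q \<oplus> s \<otimes> b) \<oplus> (r \<otimes> a \<otimes> q \<oplus> r \<otimes> s \<otimes> (a \<otimes> b))"
        using h(2,5) ab c by algebra
      also have "\<dots> \<in> P"
        using h ab c by (intro P.a_closed) (auto intro: P.I_r_closed P.I_l_closed)
      finally show False using mult[OF h(3,6)] P by (auto simp: F_def)
    qed
  qed
  with P show ?thesis by (intro that) (auto simp: F_def)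
qed

text \<open>Lets \<open>exists_primeideal_disjoint\<close> be applied to the boundary set itself.
  Powers of x multiply to powers of x, and in the product of two brackets every term except t t'
  carries a factor x.\<close>

lemma boundary_set_mult_closed:
  assumes B: "B \<subseteq> carrier R" "\<one> \<in> B" "\<And>a b. a \<in> B \<Longrightarrow> b \<in> B \<Longrightarrow> a \<otimes> b \<in> B"
    and "set xs \<subseteq> carrier R"
  shows "\<one> \<in> boundary_set R B xs \<and>
    (\<forall>s \<in> boundary_set R B xs. \<forall>t \<in> boundary_set R B xs. s \<otimes> t \<in> boundary_set R B xs)"
  using assms(4)
proof (induction xs)
  case Nil
  then show ?case using B by simp
next
  case (Cons x xs)
  let ?T = "boundary_set R B xs"
  have x: "x \<in> carrier R" and T: "?T \<subseteq> carrier R"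
    using Cons.prems boundary_set_closed[OF B(1), of xs] by auto
  have "\<one> = x [^] (0::nat) \<otimes> (\<one> \<oplus> \<zero> \<otimes> x)" using x by simp
  moreover have "\<one> \<in> ?T" using Cons by simp
  ultimately have "\<one> \<in> boundary_set R B (x # xs)"
    using boundary_set_ConsI[OF _ zero_closed] by metis
  moreover have "s \<otimes> s' \<in> boundary_set R B (x # xs)"
    if ss: "s \<in> boundary_set R B (x # xs)" "s' \<in> boundary_set R B (x # xs)" for s s'
  proof -
    obtain m t a where s: "s = x [^] (m::nat) \<otimes> (t \<oplus> a \<otimes> x)" "t \<in> ?T" "a \<in> carrier R"
      using ss by auto
    obtain m' t' a' where s': "s' = x [^] (m'::nat) \<otimes> (t' \<oplus> a' \<otimes> x)" "t' \<in> ?T" "a' \<in> carrier R"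
      using ss by auto
    have c: "t \<in> carrier R" "t' \<in> carrier R" using s s' T by auto
    have "s \<otimes> s' = x [^] (m + m') \<otimes> (t \<otimes> t' \<oplus> (t \<otimes> a' \<oplus> a \<otimes> t' \<oplus> a \<otimes> a' \<otimes> x) \<otimes> x)"
      unfolding s(1) s'(1) nat_pow_mult[OF x, symmetric]
      using s(3) s'(3) c x nat_pow_closed[OF x] by algebra
    moreover have "t \<otimes> t' \<in> ?T" using Cons s s' by auto
    moreover have "t \<otimes> a' \<oplus> a \<otimes> t' \<oplus> a \<otimes> a' \<otimes> x \<in> carrier R" using s(3) s'(3) c x by simp
    ultimately show ?thesis using boundary_set_ConsI by metis
  qed
  ultimately show ?case by blast
qed

text \<open>If a prime P misses the boundary set of \<open>x # xs\<close>, then it misses x, and P +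
  (x) misses the boundary set of \<open>xs\<close>; so the next prime can be chosen above P + (x).
  For \<open>B = {\<one>}\<close> and \<open>I\<close> the zero ideal the hypothesis says that the
  elementary chain does not collapse.\<close>

lemma prime_chain_of_boundary_set:
  assumes B: "B \<subseteq> carrier R" "\<one> \<in> B" "\<And>a b. a \<in> B \<Longrightarrow> b \<in> B \<Longrightarrow> a \<otimes> b \<in> B"
    and "set xs \<subseteq> carrier R" "ideal I R" "I \<inter> boundary_set R B xs = {}"
  shows "\<exists>p. I \<subseteq> p 0 \<and> (\<forall>i\<le>length xs. primeideal (p i) R) \<and>
    (\<forall>i<length xs. p i \<subseteq> p (Suc i) \<and> xs ! i \<in> p (Suc i) - p i)"
  using assms(4-6)
proof (induction xs arbitrary: I)
  case Nil
  with B obtain P where "primeideal P R" "I \<subseteq> P" by (metis exists_primeideal_disjoint boundary_set.simps(1))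
  then show ?case by (intro exI[of _ "\<lambda>_. P"]) auto
next
  case (Cons x xs)
  let ?T = "boundary_set R B xs"
  have x: "x \<in> carrier R" and T: "?T \<subseteq> carrier R" "\<one> \<in> ?T"
    using Cons.prems boundary_set_closed[OF B(1), of xs] boundary_set_mult_closed[OF B, of xs] by auto
  note mc = boundary_set_mult_closed[OF B Cons.prems(1)]
  from exists_primeideal_disjoint[OF Cons.prems(2) boundary_set_closed[OF B(1) Cons.prems(1)] _ _ Cons.prems(3)] mc
  obtain P where P: "primeideal P R" "I \<subseteq> P" "P \<inter> boundary_set R B (x # xs) = {}" by metis
  interpret P: primeideal P R by (rule P(1))
  have T1: "t \<oplus> a \<otimes> x \<in> boundary_set R B (x # xs)" if "t \<in> ?T" "a \<in> carrier R" for t a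
  proof -
    have "t \<oplus> a \<otimes> x = x [^] (0::nat) \<otimes> (t \<oplus> a \<otimes> x)" using that x T by auto
    then show ?thesis using boundary_set_ConsI[OF that] by metis
  qed
  have "x = x [^] (1::nat) \<otimes> (\<one> \<oplus> \<zero> \<otimes> x)" using x by simp
  then have "x \<in> boundary_set R B (x # xs)" using boundary_set_ConsI[OF T(2) zero_closed] by metis
  then have xP: "x \<notin> P" using P(3) by blast
  obtain J where J: "ideal J R" "P \<subseteq> J" "x \<in> J"
    "\<And>y. y \<in> J \<Longrightarrow> \<exists>p\<in>P. \<exists>r\<in>carrier R. y = p \<oplus> r \<otimes> x"
    using ideal_adjoin[OF P.is_ideal x] by blast
  have "J \<inter> ?T = {}"
  proof (rule ccontr)
    assume "J \<inter> ?T \<noteq> {}"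
    then obtain p r where pr: "p \<in> P" "r \<in> carrier R" "p \<oplus> r \<otimes> x \<in> ?T"
      using J(4) by blast
    \<comment> \<open>Solving p + r x = t for p shows p as t - r x, an element of the larger
      boundary set with exponent 0.\<close>
    have "p = (p \<oplus> r \<otimes> x) \<oplus> (\<ominus> r) \<otimes> x"
      using pr x P.Icarr[OF pr(1)] by algebra
    then have "p \<in> boundary_set R B (x # xs)" using T1[OF pr(3), of "\<ominus> r"] pr by simp
    then show False using P(3) pr(1) by blast
  qed
  with Cons.IH[OF _ J(1)] Cons.prems obtain p where p: "J \<subseteq> p 0"
    "\<forall>i\<le>length xs. primeideal (p i) R"
    "\<forall>i<length xs. p i \<subseteq> p (Suc i) \<and> xs ! i \<in> p (Suc i) - p i" by auto
  show ?case
    using P(1,2) p J xP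
    by (intro exI[of _ "case_nat P p"]) (auto simp: less_Suc_eq_0_disj le_Suc_eq split: nat.split)
qed

text \<open>Converse of the construction of primes. The inner t misses the second prime, which
  contains x, so t + a x misses it too and thereby also the smaller first prime. The powers of x
  miss the first prime as well, and primality handles the product.\<close>

lemma boundary_set_disjoint_prime:
  assumes "B \<subseteq> carrier R" "set xs \<subseteq> carrier R" "\<And>i. i \<le> length xs \<Longrightarrow> primeideal (p i) R"
    and "\<And>i. i < length xs \<Longrightarrow> p i \<subseteq> p (Suc i) \<and> xs ! i \<in> p (Suc i) - p i"
    and "B \<inter> p (length xs) = {}"
  shows "boundary_set R B xs \<inter> p 0 = {}"
  using assms(2-5)
proof (induction xs arbitrary: p)
  case Nil
  then show ?case by simp
next
  case (Cons x xs)
  have IH: "boundary_set R B xs \<inter> p (Suc 0) = {}"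
    using Cons.prems by (intro Cons.IH[of "p \<circ> Suc", simplified]) force+
  have x: "x \<in> carrier R" and T: "boundary_set R B xs \<subseteq> carrier R"
    using Cons.prems boundary_set_closed[OF assms(1), of xs] by auto
  interpret P: primeideal "p 0" R using Cons.prems by auto
  interpret Q: primeideal "p (Suc 0)" R using Cons.prems(2)[of "Suc 0"] by simp
  have PQ: "p 0 \<subseteq> p (Suc 0)" "x \<in> p (Suc 0)" "x \<notin> p 0" using Cons.prems(3)[of 0] by auto
  have "x [^] m \<notin> p 0" for m :: nat
  proof (induction m)
    case 0
    show ?case using P.I_notcarr P.one_imp_carrier by auto
  next
    case (Suc m)
    then show ?case using P.I_prime[of "x [^] m" x] x PQ by auto
  qed
  moreover have "t \<oplus> a \<otimes> x \<notin> p (Suc 0)" if "t \<in> boundary_set R B xs" "a \<in> carrier R" for t a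
  proof
    assume "t \<oplus> a \<otimes> x \<in> p (Suc 0)"
    then have "(t \<oplus> a \<otimes> x) \<oplus> (\<ominus> a) \<otimes> x \<in> p (Suc 0)"
      by (rule Q.a_closed) (use that PQ in \<open>auto intro: Q.I_l_closed\<close>)
    moreover have "t \<in> carrier R" using that T by auto
    then have "(t \<oplus> a \<otimes> x) \<oplus> (\<ominus> a) \<otimes> x = t" using that x by algebra
    ultimately show False using that IH by auto
  qed
  ultimately have "x [^] m \<otimes> (t \<oplus> a \<otimes> x) \<notin> p 0"
    if "t \<in> boundary_set R B xs" "a \<in> carrier R" for m :: nat and t a
  proof -
    have "t \<in> carrier R" using that T by blast
    then show ?thesis
      using \<open>\<And>m::nat. x [^] m \<notin> p 0\<close> \<open>\<And>t a. \<lbrakk>t \<in> boundary_set R B xs; a \<in> carrier R\<rbrakk> \<Longrightarrow> t \<oplus> a \<otimes> x \<notin> p (Suc 0)\<close>[OF that]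
        P.I_prime[of "x [^] m" "t \<oplus> a \<otimes> x"] that(2) x PQ(1) by blast
  qed
  then show ?case by (simp add: disjoint_iff) blast
qed


lemma monoid_generated_disjoint_prime:
  assumes "primeideal P R" "U \<subseteq> carrier R" "U \<inter> P = {}"
  shows "monoid_generated R U \<inter> P = {}"
proof -
  interpret P: primeideal P R by fact
  have "x \<notin> P" if "x \<in> monoid_generated R U" for x
    using that
  proof induction
    case one
    then show ?case using P.I_notcarr P.one_imp_carrier by auto
  next
    case (incl u)
    then show ?case using assms by auto
  next
    case (prod u v)
    then show ?case
      using P.I_prime[of u v] monoid_generated_closed[OF assms(2)] by auto
  qed
  then show ?thesis by auto
qed

lemma strict_prime_chain_elements:
  assumes "\<And>i. i \<le> k \<Longrightarrow> primeideal (p i) R" "\<And>i. i < k \<Longrightarrow> p i \<subset> p (Suc i)"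
  obtains xs where "length xs = k" "set xs \<subseteq> carrier R"
    "\<And>i. i < k \<Longrightarrow> p i \<subseteq> p (Suc i) \<and> xs ! i \<in> p (Suc i) - p i"
proof -
  have "\<exists>x. x \<in> p (Suc i) - p i" if "i < k" for i
    using assms(2)[OF that] by blast
  then obtain f where f: "\<And>i. i < k \<Longrightarrow> f i \<in> p (Suc i) - p i"
    by metis
  have "f i \<in> carrier R" if "i < k" for i
  proof -
    interpret primeideal "p (Suc i)" R using assms(1)[of "Suc i"] that by simp
    show ?thesis using f[OF that] Icarr by blast
  qed
  then show ?thesis
    using f assms(2) by (intro that[of "map f [0..<k]"]) auto
qed

lemma krull_dim_le_no_prime_chain:
  assumes "krull_dim_le R (int k)"
    and p: "\<And>i. i \<le> Suc k \<Longrightarrow> primeideal (p i) R" "\<And>i. i < Suc k \<Longrightarrow> p i \<subset> p (Suc i)"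
  shows False
proof -
  obtain xs where xs: "length xs = Suc k" "set xs \<subseteq> carrier R"
    "\<And>i. i < Suc k \<Longrightarrow> p i \<subseteq> p (Suc i) \<and> xs ! i \<in> p (Suc i) - p i"
    using strict_prime_chain_elements[of "Suc k" p] p by blast
  have "collapses R (elementary_chain R xs)"
    using assms(1) xs(1,2) by (auto simp: krull_dim_le_def)
  then have "\<zero> \<in> boundary_set R {\<one>} xs" using collapses_elementary_iff xs by simp
  moreover have "boundary_set R {\<one>} xs \<inter> p 0 = {}"
  proof (rule boundary_set_disjoint_prime)
    have "primeideal (p (length xs)) R" using p(1) xs by simp
    then show "{\<one>} \<inter> p (length xs) = {}"
      using primeideal.I_notcarr ideal.one_imp_carrier primeideal.axioms(1) by fastforce
  qed (use xs p in auto)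
  moreover have "\<zero> \<in> p 0"
    using p(1)[of 0] additive_subgroup.zero_closed ideal.axioms(1) primeideal.axioms(1) by blast
  ultimately show False by auto
qed

text \<open>Declare zero exactly those members of the family that lie in the lowest prime. By
  \<open>pK\<close> the others avoid even the top prime, hence so does the monoid they generate; the
  boundary set then avoids the lowest prime, while the adjoined ideal is contained in it.\<close>

lemma not_collapses_above_prime_chain:
  assumes K: "K \<subseteq> carrier R" and xs: "set xs \<subseteq> carrier R"
    and p: "\<And>i. i \<le> length xs \<Longrightarrow> primeideal (p i) R"
    "\<And>i. i < length xs \<Longrightarrow> p i \<subseteq> p (Suc i) \<and> xs ! i \<in> p (Suc i) - p i"
    and pK: "p (length xs) \<inter> K \<subseteq> p 0"
  shows "\<not> collapses_above R K (elementary_chain R xs)"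
proof
  assume "collapses_above R K (elementary_chain R xs)"
  then obtain as where as: "set as \<subseteq> K" and coll: "\<forall>H H'. H \<union> H' = {..<length as} \<and> H \<inter> H' = {} \<longrightarrow>
      collapses R (adjoin_last ((!) as ` H') (adjoin_first ((!) as ` H) (elementary_chain R xs)))"
    unfolding collapses_above_def by (elim exE conjE)
  define H where "H = {i. i < length as \<and> as ! i \<in> p 0}"
  define H' where "H' = {i. i < length as \<and> as ! i \<notin> p 0}"
  let ?A = "(!) as ` H" and ?V = "(!) as ` H'"
  have car: "?A \<subseteq> carrier R" "?V \<subseteq> carrier R" and V: "?V \<subseteq> K"
    using as K by (force simp: H_def H'_def)+
  have "H \<union> H' = {..<length as} \<and> H \<inter> H' = {}" by (auto simp: H_def H'_def)
  from coll[rule_format, OF this] obtain t j where t: "t \<in> boundary_set R (monoid_generated R (insert \<one> ?V)) xs"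
    and j: "j \<in> Idl (?A \<union> {\<zero>})" and "t \<oplus> j = \<zero>"
    unfolding collapses_adjoined_elementary_iff[OF car xs] by blast
  interpret P: primeideal "p 0" R using p(1) by simp
  interpret Q: primeideal "p (length xs)" R using p(1) by simp
  have mc: "monoid_generated R (insert \<one> ?V) \<subseteq> carrier R"
    using car by (intro monoid_generated_closed) auto
  have "\<one> \<notin> p (length xs)" using Q.I_notcarr Q.one_imp_carrier by auto
  then have "insert \<one> ?V \<inter> p (length xs) = {}"
    using V pK by (auto simp: H'_def)
  then have "monoid_generated R (insert \<one> ?V) \<inter> p (length xs) = {}"
    using car by (intro monoid_generated_disjoint_prime Q.primeideal) auto
  then have "boundary_set R (monoid_generated R (insert \<one> ?V)) xs \<inter> p 0 = {}"
    using mc xs p by (intro boundary_set_disjoint_prime) auto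
  then have "t \<notin> p 0" using t by blast
  have "Idl (?A \<union> {\<zero>}) \<subseteq> p 0"
    by (rule genideal_minimal[OF P.is_ideal]) (auto simp: H_def)
  then have jP: "j \<in> p 0" using j by blast
  have "t \<in> carrier R" using t boundary_set_closed[OF mc xs] by blast
  then have "t = \<ominus> j"
    using \<open>t \<oplus> j = \<zero>\<close> P.Icarr[OF jP] minus_equality by metis
  then show False using \<open>t \<notin> p 0\<close> P.a_inv_closed[OF jP] by simp
qed

end

section \<open>Absolute dimension from relative dimension: contraction of prime chains\<close>

lemma (in ring_hom_cring) krull_dim_le_of_relative:
  assumes rel: "rel_krull_dim_le S (h ` carrier R) (int n)"
    and abs: "krull_dim_le R r"
  shows "krull_dim_le S (r + int n + r * int n)"
proof (cases "r = -1")
  case True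
  \<comment> \<open>For r = -1 the bound r + n + rn is again -1, so triviality of the ring is what
    has to be transported.\<close>
  then have "\<one> = \<zero>" using abs by (simp add: krull_dim_le_def)
  then have "\<one>\<^bsub>S\<^esub> = \<zero>\<^bsub>S\<^esub>" using hom_one hom_zero by metis
  then show ?thesis using True by (simp add: krull_dim_le_def)
next
  case False
  then obtain k where k: "r = int k" using abs nonneg_int_cases by (auto simp: krull_dim_le_def)
  \<comment> \<open>The sequence length that belongs to the bound: (n + 1)(k + 1) = k + n + kn +
    1.\<close>
  define N where "N = Suc n * Suc k"
  have d: "r + int n + r * int n + 1 = int N" by (simp add: N_def k algebra_simps)
  have "collapses S (elementary_chain S xs)" if xs: "set xs \<subseteq> carrier S" "length xs = N" for xs
  proof (rule ccontr)
    assume "\<not> collapses S (elementary_chain S xs)"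
    then have "{\<zero>\<^bsub>S\<^esub>} \<inter> boundary_set S {\<one>\<^bsub>S\<^esub>} xs = {}" using S.collapses_elementary_iff xs(1) by simp
    from S.prime_chain_of_boundary_set[OF _ _ _ xs(1) S.zeroideal this]
    obtain p where p: "\<And>i. i \<le> N \<Longrightarrow> primeideal (p i) S"
      "\<And>i. i < N \<Longrightarrow> p i \<subseteq> p (Suc i) \<and> xs ! i \<in> p (Suc i) - p i"
      unfolding xs(2) by auto
    define q where "q i = {a \<in> carrier R. h a \<in> p i}" for i
    have q: "primeideal (q i) R" if "i \<le> N" for i
      unfolding q_def using ring.primeideal_vimage[OF R.is_cring p(1)[OF that]] .
    have mono: "p i \<subseteq> p j" if "i \<le> j" "j \<le> N" for i j
        using that
    proof (induction j rule: dec_induct)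
      case (step l)
      then show ?case using p(2)[of l] by auto
    qed simp
    have strict: "q i \<subset> q (i + Suc n)" if i: "i + Suc n \<le> N" for i
    proof (rule ccontr)
      have "q i \<subseteq> q (i + Suc n)" using mono[of i "i + Suc n"] i by (auto simp: q_def)
      moreover assume "\<not> q i \<subset> q (i + Suc n)"
      ultimately have eq: "q (i + Suc n) = q i" by blast
      \<comment> \<open>The n + 2 primes from index i to i + n + 1, and the n + 1 entries of
        \<open>xs\<close> that separate them. As the outer two have the same contraction, these
        entries cannot collapse above the image of \<open>R\<close>.\<close>
      let ?p = "\<lambda>l. p (i + l)" and ?ys = "take (Suc n) (drop i xs)"
      have len: "length ?ys = Suc n" using i xs by simp
      have ys: "set ?ys \<subseteq> carrier S"
        using xs(1) set_take_subset[of "Suc n" "drop i xs"] set_drop_subset[of i xs] by blast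
      have "\<not> collapses_above S (h ` carrier R) (elementary_chain S ?ys)"
      proof (rule S.not_collapses_above_prime_chain[OF _ ys, of _ ?p])
        show "?p (length ?ys) \<inter> h ` carrier R \<subseteq> ?p 0"
          unfolding len using eq by (auto simp: q_def)
      qed (use i p len xs in \<open>auto simp: image_subset_iff\<close>)
      moreover have "collapses_above S (h ` carrier R) (elementary_chain S ?ys)"
        using rel ys len unfolding rel_krull_dim_le_def by auto
      ultimately show False by blast
    qed
    \<comment> \<open>Every (n + 1)-st contraction is used: k + 2 primes with strict inclusions,
      which dimension k excludes.\<close>
    show False
    proof (rule R.krull_dim_le_no_prime_chain[of k "\<lambda>i. q (i * Suc n)"])
      show "krull_dim_le R (int k)" using abs k by simp
      have le: "i * Suc n \<le> N" if "i \<le> Suc k" for i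
        unfolding N_def using mult_le_mono1[OF that, of "Suc n"] by (simp add: mult.commute)
      show "primeideal (q (i * Suc n)) R" if "i \<le> Suc k" for i
        using q le that by blast
      show "q (i * Suc n) \<subset> q (Suc i * Suc n)" if "i < Suc k" for i
        using strict[of "i * Suc n"] le[of "Suc i"] that by (simp add: ac_simps)
    qed
  qed
  then show ?thesis
    using d k by (auto simp: krull_dim_le_def)
qed

section \<open>The polynomial ring\<close>

lemma finite_submultisets: "finite {k. k \<subseteq># m}"
proof (induction m)
  case (add i m)
  have "{k. k \<subseteq># add_mset i m} \<subseteq> {k. k \<subseteq># m} \<union> add_mset i ` {k. k \<subseteq># m}"
  proof
    fix k assume k: "k \<in> {k. k \<subseteq># add_mset i m}"
    show "k \<in> {k. k \<subseteq># m} \<union> add_mset i ` {k. k \<subseteq># m}"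
    proof (cases "i \<in># k")
      case True
      then obtain k' where "k = add_mset i k'" by (metis mset_add)
      then show ?thesis using k by auto
    next
      case False
      have "count k a \<le> count m a" for a
        using False mset_subset_eq_count[of k "add_mset i m" a] k
        by (cases "a = i") (auto simp: not_in_iff)
      then show ?thesis by (simp add: subseteq_mset_def)
    qed
  qed
  then show ?case using add finite_subset by blast
qed simp

lemma submultiset_diff_diff: "k \<subseteq># m \<Longrightarrow> m - (m - k) = k"
  by (auto simp: multiset_eq_iff subseteq_mset_def)

section \<open>The Cauchy product and the ring axioms\<close>

context cring
begin

text \<open>Free of the number of variables, so that most of its laws can be proved for arbitrary
  coefficient functions satisfying \<open>carrier_coeff\<close>.\<close>

definition cauchy :: "(nat multiset \<Rightarrow> 'a) \<Rightarrow> (nat multiset \<Rightarrow> 'a) \<Rightarrow> nat multiset \<Rightarrow> 'a" where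
  "cauchy p q = (\<lambda>m. \<Oplus>k \<in> {k. k \<subseteq># m}. p k \<otimes> q (m - k))"

lemma cauchy_coeff [simp]:
  assumes "carrier_coeff p" "carrier_coeff q"
  shows "carrier_coeff (cauchy p q)"
  using assms by (auto simp: carrier_coeff_def cauchy_def intro!: finsum_closed)

lemma cauchy_comm:
  assumes p: "carrier_coeff p" and q: "carrier_coeff q"
  shows "cauchy p q = cauchy q p"
proof
  fix m :: "nat multiset"
  have c: "p k \<in> carrier R" "q k \<in> carrier R" for k
    using p q by (simp_all add: carrier_coeff_def)
  have img: "{k. k \<subseteq># m} = (\<lambda>k. m - k) ` {k. k \<subseteq># m}"
  proof (intro equalityI subsetI)
    fix k assume "k \<in> {k. k \<subseteq># m}"
    then have "k = m - (m - k)" "m - k \<subseteq># m"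
      by (simp_all add: submultiset_diff_diff)
    then show "k \<in> (\<lambda>k. m - k) ` {k. k \<subseteq># m}" by blast
  qed auto
  have inj: "inj_on (\<lambda>k. m - k) {k. k \<subseteq># m}"
  proof (rule inj_onI)
    fix k l assume "k \<in> {k. k \<subseteq># m}" "l \<in> {k. k \<subseteq># m}" and e: "m - k = m - l"
    have "k = m - (m - k)" using \<open>k \<in> _\<close> by (simp add: submultiset_diff_diff)
    also have "\<dots> = l" unfolding e using \<open>l \<in> _\<close> by (simp add: submultiset_diff_diff)
    finally show "k = l" .
  qed
  have "cauchy p q m = (\<Oplus>k \<in> (\<lambda>k. m - k) ` {k. k \<subseteq># m}. p k \<otimes> q (m - k))"
    unfolding cauchy_def by (subst img) simp
  also have "\<dots> = (\<Oplus>k \<in> {k. k \<subseteq># m}. p (m - k) \<otimes> q (m - (m - k)))"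
    by (rule finsum_reindex) (auto simp: c inj)
  also have "\<dots> = cauchy q p m"
    unfolding cauchy_def
  proof (rule finsum_cong')
    fix k assume "k \<in> {k. k \<subseteq># m}"
    then have "m - (m - k) = k" by (simp add: submultiset_diff_diff)
    then show "p (m - k) \<otimes> q (m - (m - k)) = q k \<otimes> p (m - k)" by (simp add: m_comm c)
  qed (auto simp: c)
  finally show "cauchy p q m = cauchy q p m" .
qed

lemma cauchy_indexed_const:
  assumes "a \<in> carrier R" "carrier_coeff q"
  shows "cauchy (indexed_const a) q = (\<lambda>m. a \<otimes> q m)"
proof
  fix m :: "nat multiset"
  have c: "q k \<in> carrier R" for k
    using assms by (simp add: carrier_coeff_def)
  have "cauchy (indexed_const a) q m = (\<Oplus>k \<in> {k. k \<subseteq># m}. if {#} = k then a \<otimes> q m else \<zero>)"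
    unfolding cauchy_def indexed_const_def
    by (rule finsum_cong') (use assms c in auto)
  also have "\<dots> = a \<otimes> q m"
    using assms c by (intro add.finprod_singleton) (auto simp: finite_submultisets)
  finally show "cauchy (indexed_const a) q m = a \<otimes> q m" .
qed

lemma cauchy_indexed_padd:
  assumes "carrier_coeff p" "carrier_coeff p'" "carrier_coeff q"
  shows "cauchy (indexed_padd p p') q = indexed_padd (cauchy p q) (cauchy p' q)"
proof
  fix m :: "nat multiset"
  have c: "p k \<in> carrier R" "p' k \<in> carrier R" "q k \<in> carrier R" for k
    using assms by (simp_all add: carrier_coeff_def)
  have "cauchy (indexed_padd p p') q m = (\<Oplus>k \<in> {k. k \<subseteq># m}. p k \<otimes> q (m - k) \<oplus> p' k \<otimes> q (m - k))"
    unfolding cauchy_def indexed_padd_def by (rule finsum_cong') (auto simp: c l_distr)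
  also have "\<dots> = indexed_padd (cauchy p q) (cauchy p' q) m"
    unfolding cauchy_def indexed_padd_def by (rule finsum_addf) (auto simp: c)
  finally show "cauchy (indexed_padd p p') q m = indexed_padd (cauchy p q) (cauchy p' q) m" .
qed

text \<open>The divisors of \<open>m\<close> that contain \<open>i\<close> are the divisors of m /
  X_i with \<open>i\<close> added, and at all other divisors the factor
  \<open>indexed_pmult p i\<close> has coefficient 0. With the rules for constants and sums,
  identities for \<open>cauchy\<close> become inductions on how the first factor is built.\<close>

lemma cauchy_indexed_pmult:
  assumes "carrier_coeff p" "carrier_coeff q"
  shows "cauchy (indexed_pmult p i) q = indexed_pmult (cauchy p q) i"
proof
  fix m :: "nat multiset"
  have c: "p k \<in> carrier R" "q k \<in> carrier R" for k
    using assms by (simp_all add: carrier_coeff_def)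
  let ?f = "\<lambda>k. indexed_pmult p i k \<otimes> q (m - k)"
  have cf: "?f k \<in> carrier R" for k by (simp add: c indexed_pmult_def)
  show "cauchy (indexed_pmult p i) q m = indexed_pmult (cauchy p q) i m"
  proof (cases "i \<in># m")
    case False
    have "cauchy (indexed_pmult p i) q m = (\<Oplus>k \<in> {k. k \<subseteq># m}. \<zero>)"
      unfolding cauchy_def
      by (rule finsum_cong') (use False c mset_subset_eqD in \<open>fastforce simp: indexed_pmult_def\<close>)+
    then show ?thesis using False by (simp add: indexed_pmult_def)
  next
    case True
    define m' where "m' = m - {#i#}"
    have m: "m = add_mset i m'" using True by (simp add: m'_def)
    have split: "{k. k \<subseteq># m} = add_mset i ` {k. k \<subseteq># m'} \<union> {k. k \<subseteq># m \<and> i \<notin># k}"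
    proof (intro equalityI subsetI)
      fix k assume k: "k \<in> {k. k \<subseteq># m}"
      show "k \<in> add_mset i ` {k. k \<subseteq># m'} \<union> {k. k \<subseteq># m \<and> i \<notin># k}"
      proof (cases "i \<in># k")
        case True
        then obtain k' where "k = add_mset i k'" by (metis mset_add)
        then show ?thesis using k by (auto simp: m)
      qed (use k in auto)
    qed (auto simp: m)
    have "cauchy (indexed_pmult p i) q m =
        (\<Oplus>k \<in> add_mset i ` {k. k \<subseteq># m'}. ?f k) \<oplus> (\<Oplus>k \<in> {k. k \<subseteq># m \<and> i \<notin># k}. ?f k)"
      unfolding cauchy_def split
    proof (rule finsum_Un_disjoint)
      show "finite {k. k \<subseteq># m \<and> i \<notin># k}" by (rule finite_subset[OF _ finite_submultisets[of m]]) auto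
    qed (auto simp: cf finite_submultisets)
    also have "(\<Oplus>k \<in> {k. k \<subseteq># m \<and> i \<notin># k}. ?f k) = (\<Oplus>k \<in> {k. k \<subseteq># m \<and> i \<notin># k}. \<zero>)"
      by (rule finsum_cong') (auto simp: indexed_pmult_def c)
    also have "(\<Oplus>k \<in> add_mset i ` {k. k \<subseteq># m'}. ?f k) = (\<Oplus>k \<in> {k. k \<subseteq># m'}. ?f (add_mset i k))"
      by (rule finsum_reindex) (auto simp: cf inj_on_def)
    also have "\<dots> = cauchy p q m'"
      unfolding cauchy_def by (rule finsum_cong') (auto simp: c indexed_pmult_def m)
    finally show ?thesis
      using True carrier_coeffE[OF cauchy_coeff[OF assms]] by (simp add: indexed_pmult_def m'_def)
  qed
qed

text \<open>Written with \<open>Suc 0\<close> to agree with the form into which the simplifier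
  brings the lower bound 1.\<close>

abbreviation mpolys :: "nat \<Rightarrow> (nat multiset \<Rightarrow> 'a) set" where
  "mpolys n \<equiv> indexed_pset {Suc 0..n} (carrier R)"

lemma mpolys_coeff: "p \<in> mpolys n \<Longrightarrow> carrier_coeff p"
  by (rule indexed_pset_in_carrier[OF subset_refl])

lemma mpoly_ring_simps [simp]:
  "carrier (mpoly_ring R n) = mpolys n"
  "monoid.mult (mpoly_ring R n) = cauchy"
  "one (mpoly_ring R n) = indexed_const \<one>"
  "zero (mpoly_ring R n) = indexed_const \<zero>"
  "add (mpoly_ring R n) = indexed_padd"
  by (simp_all add: mpoly_ring_def cauchy_def fun_eq_iff)

lemma indexed_const_mult_mpolys:
  assumes "q \<in> mpolys n" "a \<in> carrier R"
  shows "(\<lambda>m. a \<otimes> q m) \<in> mpolys n"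
  using assms(1)
proof induction
  case (indexed_const k)
  have "(\<lambda>m :: nat multiset. a \<otimes> indexed_const k m) = indexed_const (a \<otimes> k)"
    using assms(2) by (auto simp: indexed_const_def)
  then show ?case
    using indexed_pset.indexed_const[of "a \<otimes> k" "carrier R"] indexed_const assms(2) by simp
next
  case (indexed_padd p q)
  have "(\<lambda>m. a \<otimes> indexed_padd p q m) = indexed_padd (\<lambda>m. a \<otimes> p m) (\<lambda>m. a \<otimes> q m)"
    using assms(2) mpolys_coeff[OF indexed_padd.hyps(1)] mpolys_coeff[OF indexed_padd.hyps(2)]
    by (auto simp: indexed_padd_def carrier_coeff_def r_distr)
  then show ?case using indexed_padd by (simp add: indexed_pset.indexed_padd)
next
  case (indexed_pmult p i)
  have "(\<lambda>m. a \<otimes> indexed_pmult p i m) = indexed_pmult (\<lambda>m. a \<otimes> p m) i"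
    using assms(2) by (auto simp: indexed_pmult_def)
  then show ?case using indexed_pmult by (simp add: indexed_pset.indexed_pmult)
qed

lemma cauchy_closed:
  assumes "p \<in> mpolys n" "q \<in> mpolys n"
  shows "cauchy p q \<in> mpolys n"
  using assms(1)
proof induction
  case (indexed_const k)
  then show ?case
    using assms(2) by (simp add: cauchy_indexed_const mpolys_coeff indexed_const_mult_mpolys)
next
  case (indexed_padd p p')
  then show ?case
    using assms(2) by (simp add: cauchy_indexed_padd mpolys_coeff indexed_pset.indexed_padd)
next
  case (indexed_pmult p i)
  then show ?case
    using assms(2) by (simp add: cauchy_indexed_pmult mpolys_coeff indexed_pset.indexed_pmult)
qed

text \<open>Induction on \<open>p\<close> avoids rearranging a double sum: sums and multiplication
  by a variable pass through both products, and what remains is to pull a constant out of one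
  sum.\<close>

lemma cauchy_assoc:
  assumes "p \<in> mpolys n" "q \<in> mpolys n" "r \<in> mpolys n"
  shows "cauchy (cauchy p q) r = cauchy p (cauchy q r)"
  using assms(1)
proof induction
  case (indexed_const a)
  have c: "q k \<in> carrier R" "r k \<in> carrier R" for k
    using assms(2,3) mpolys_coeff by (auto simp: carrier_coeff_def)
  have "cauchy (\<lambda>m. a \<otimes> q m) r = (\<lambda>m. a \<otimes> cauchy q r m)"
  proof
    fix m
    have "cauchy (\<lambda>m. a \<otimes> q m) r m = (\<Oplus>k \<in> {k. k \<subseteq># m}. a \<otimes> (q k \<otimes> r (m - k)))"
      unfolding cauchy_def by (rule finsum_cong') (use indexed_const in \<open>auto simp: c m_assoc\<close>)
    also have "\<dots> = a \<otimes> cauchy q r m"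
      unfolding cauchy_def
      by (rule finsum_rdistr[symmetric]) (use indexed_const in \<open>auto simp: c finite_submultisets\<close>)
    finally show "cauchy (\<lambda>m. a \<otimes> q m) r m = a \<otimes> cauchy q r m" .
  qed
  then show ?case using assms(2,3) indexed_const by (simp add: cauchy_indexed_const mpolys_coeff)
next
  case (indexed_padd p p')
  then show ?case
    using assms(2,3) by (simp add: cauchy_indexed_padd mpolys_coeff)
next
  case (indexed_pmult p i)
  then show ?case
    using assms(2,3) by (simp add: cauchy_indexed_pmult mpolys_coeff)
qed

lemma mpoly_cring: "cring (mpoly_ring R n)"
proof (rule cringI)
  \<comment> \<open>The additive inverse is taken as the scalar multiple by -1, which
    \<open>indexed_const_mult_mpolys\<close> shows to be a polynomial.\<close>
  have minus: "indexed_padd (\<lambda>m. \<ominus> \<one> \<otimes> p m) p = indexed_const \<zero>" if "p \<in> mpolys n" for p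
    using mpolys_coeff[OF that]
    by (auto simp: indexed_padd_def indexed_zero_def carrier_coeff_def l_minus l_neg)
  show "abelian_group (mpoly_ring R n)"
  proof (rule abelian_groupI)
    fix p q r assume "p \<in> carrier (mpoly_ring R n)" "q \<in> carrier (mpoly_ring R n)" "r \<in> carrier (mpoly_ring R n)"
    then have "carrier_coeff p" "carrier_coeff q" "carrier_coeff r" by (simp_all add: mpolys_coeff)
    then show "p \<oplus>\<^bsub>mpoly_ring R n\<^esub> q \<oplus>\<^bsub>mpoly_ring R n\<^esub> r = p \<oplus>\<^bsub>mpoly_ring R n\<^esub> (q \<oplus>\<^bsub>mpoly_ring R n\<^esub> r)"
      by (simp add: indexed_padd_def carrier_coeff_def a_assoc)
  next
    fix p q assume "p \<in> carrier (mpoly_ring R n)" "q \<in> carrier (mpoly_ring R n)"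
    then have "carrier_coeff p" "carrier_coeff q" by (simp_all add: mpolys_coeff)
    then show "p \<oplus>\<^bsub>mpoly_ring R n\<^esub> q = q \<oplus>\<^bsub>mpoly_ring R n\<^esub> p"
      by (simp add: indexed_padd_def carrier_coeff_def a_comm)
  next
    fix p assume "p \<in> carrier (mpoly_ring R n)"
    then show "\<zero>\<^bsub>mpoly_ring R n\<^esub> \<oplus>\<^bsub>mpoly_ring R n\<^esub> p = p"
      by (simp add: indexed_padd_zero(2) mpolys_coeff)
    show "\<exists>q\<in>carrier (mpoly_ring R n). q \<oplus>\<^bsub>mpoly_ring R n\<^esub> p = \<zero>\<^bsub>mpoly_ring R n\<^esub>"
      using \<open>p \<in> _\<close> minus[of p] indexed_const_mult_mpolys[of p n "\<ominus> \<one>"]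
      by (intro bexI[of _ "\<lambda>m. \<ominus> \<one> \<otimes> p m"]) simp_all
  qed (auto intro: indexed_pset.indexed_padd indexed_pset.indexed_const)
  show "comm_monoid (mpoly_ring R n)"
  proof (rule comm_monoidI)
    fix p q assume pq: "p \<in> carrier (mpoly_ring R n)" "q \<in> carrier (mpoly_ring R n)"
    then show "p \<otimes>\<^bsub>mpoly_ring R n\<^esub> q \<in> carrier (mpoly_ring R n)"
      by (simp add: cauchy_closed)
    show "p \<otimes>\<^bsub>mpoly_ring R n\<^esub> q = q \<otimes>\<^bsub>mpoly_ring R n\<^esub> p"
      using pq by (simp add: cauchy_comm[of p q] mpolys_coeff)
  next
    fix p assume "p \<in> carrier (mpoly_ring R n)"
    then have "carrier_coeff p" by (simp add: mpolys_coeff)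
    then show "\<one>\<^bsub>mpoly_ring R n\<^esub> \<otimes>\<^bsub>mpoly_ring R n\<^esub> p = p"
      by (simp add: cauchy_indexed_const carrier_coeff_def)
  qed (auto intro: indexed_pset.indexed_const simp: cauchy_assoc)
qed (simp add: cauchy_indexed_padd mpolys_coeff)

lemma indexed_const_ring_hom: "indexed_const \<in> ring_hom R (mpoly_ring R n)"
proof (rule ring_hom_memI)
  fix a b assume ab: "a \<in> carrier R" "b \<in> carrier R"
  then show "indexed_const a \<in> carrier (mpoly_ring R n)" by (simp add: indexed_pset.indexed_const)
  have "carrier_coeff (indexed_const b :: nat multiset \<Rightarrow> 'a)"
    using ab by (auto simp: carrier_coeff_def indexed_const_def)
  then show "indexed_const (a \<otimes> b) = indexed_const a \<otimes>\<^bsub>mpoly_ring R n\<^esub> indexed_const b"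
    using ab by (simp add: cauchy_indexed_const) (auto simp: indexed_const_def fun_eq_iff)
  show "indexed_const (a \<oplus> b) = indexed_const a \<oplus>\<^bsub>mpoly_ring R n\<^esub> indexed_const b"
    by (simp add: indexed_padd_const)
qed simp

lemma mpoly_ring_hom_cring: "ring_hom_cring R (mpoly_ring R n) indexed_const"
  using mpoly_cring indexed_const_ring_hom
  by (intro ring_hom_cring.intro ring_hom_cring_axioms.intro) (auto intro: is_cring)

end

section \<open>Coefficients of collapses\<close>

lemma (in ring_hom_cring) boundary_set_hom:
  assumes "B \<subseteq> carrier R" "set xs \<subseteq> carrier R" "t \<in> boundary_set R B xs"
  shows "h t \<in> boundary_set S (h ` B) (map h xs)"
  using assms(2,3)
proof (induction xs arbitrary: t)
  case (Cons x xs)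
  from Cons.prems(2) obtain m s a where t: "t = x [^] (m::nat) \<otimes> (s \<oplus> a \<otimes> x)"
    "s \<in> boundary_set R B xs" "a \<in> carrier R" by auto
  have x: "x \<in> carrier R" and s: "s \<in> carrier R"
    using Cons.prems R.boundary_set_closed[OF assms(1), of xs] t by auto
  have "h t = h x [^]\<^bsub>S\<^esub> m \<otimes>\<^bsub>S\<^esub> (h s \<oplus>\<^bsub>S\<^esub> h a \<otimes>\<^bsub>S\<^esub> h x)"
    using x s t by (simp add: ring.hom_nat_pow)
  moreover have "h s \<in> boundary_set S (h ` B) (map h xs)" using Cons t by simp
  ultimately show ?case using S.boundary_set_ConsI[of "h s" "h ` B" "map h xs" "h a" "h x" m] t(3) by simp
qed simp

context cring
begin

lemma indexed_var_mpolys: "i \<in> {Suc 0..n} \<Longrightarrow> indexed_var i \<in> mpolys n"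
  unfolding indexed_var_def by (intro indexed_pset.indexed_pmult indexed_pset.indexed_const) auto

lemma cauchy_indexed_var:
  assumes "p \<in> mpolys n"
  shows "cauchy (indexed_var i) p = indexed_pmult p i"
proof -
  have c: "carrier_coeff p" using assms by (rule mpolys_coeff)
  have "carrier_coeff (indexed_const \<one> :: nat multiset \<Rightarrow> 'a)"
    by (auto simp: carrier_coeff_def indexed_const_def)
  then have "cauchy (indexed_var i) p = indexed_pmult (cauchy (indexed_const \<one>) p) i"
    unfolding indexed_var_def by (rule cauchy_indexed_pmult[OF _ c])
  also have "cauchy (indexed_const \<one>) p = p"
    using c by (simp add: cauchy_indexed_const carrier_coeff_def)
  finally show ?thesis .
qed

lemma indexed_var_pow_coeff:
  assumes "p \<in> mpolys n" "i \<in> {Suc 0..n}"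
  shows "(indexed_var i [^]\<^bsub>mpoly_ring R n\<^esub> k \<otimes>\<^bsub>mpoly_ring R n\<^esub> p) (replicate_mset k i + m) = p m"
proof -
  interpret S: cring "mpoly_ring R n" by (rule mpoly_cring)
  have X: "indexed_var i \<in> carrier (mpoly_ring R n)" and p: "p \<in> carrier (mpoly_ring R n)"
    using indexed_var_mpolys[OF assms(2)] assms(1) by simp_all
  show ?thesis
  proof (induction k)
    case 0
    then show ?case using p by (simp del: mpoly_ring_simps)
  next
    case (Suc k)
    let ?q = "indexed_var i [^]\<^bsub>mpoly_ring R n\<^esub> k \<otimes>\<^bsub>mpoly_ring R n\<^esub> p"
    have q: "?q \<in> carrier (mpoly_ring R n)" using X p by (simp del: mpoly_ring_simps)
    have "indexed_var i [^]\<^bsub>mpoly_ring R n\<^esub> Suc k \<otimes>\<^bsub>mpoly_ring R n\<^esub> p = indexed_var i \<otimes>\<^bsub>mpoly_ring R n\<^esub> ?q"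
      unfolding S.nat_pow_Suc2[OF X] using X p by (intro S.m_assoc S.nat_pow_closed)
    also have "\<dots> = indexed_pmult ?q i" using cauchy_indexed_var[of ?q n i] q by simp
    finally show ?case using Suc by (simp add: indexed_pmult_def del: mpoly_ring_simps)
  qed
qed

text \<open>The monomial collects the exponents met on the way inwards. In X_i^k (u + a X_i) the
  coefficient of X_i^k m is that of m in u + a X_i; the part a X_i contributes nothing, because m
  involves only the later variables, which differ from X_i. At the innermost stage m is the empty
  monomial.\<close>

lemma boundary_set_vars_coeff:
  assumes "B \<subseteq> mpolys n" "set ys \<subseteq> mpolys n"
    and "distinct is" "set is \<subseteq> {Suc 0..n}" "t \<in> boundary_set (mpoly_ring R n) B (map indexed_var is @ ys)"
  shows "\<exists>s \<in> boundary_set (mpoly_ring R n) B ys. \<exists>m. set_mset m \<subseteq> set is \<and> t m = s {#}"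
  using assms(3-5)
proof (induction "is" arbitrary: t)
  case Nil
  then show ?case by (auto intro!: exI[of _ "{#}"])
next
  case (Cons i "is")
  interpret S: cring "mpoly_ring R n" by (rule mpoly_cring)
  let ?T = "boundary_set (mpoly_ring R n) B (map indexed_var is @ ys)"
  have i: "i \<in> {Suc 0..n}" and dist: "i \<notin> set is" using Cons.prems by auto
  have "set (map indexed_var is @ ys) \<subseteq> mpolys n"
    using Cons.prems(2) assms(2) indexed_var_mpolys by auto
  then have T: "?T \<subseteq> mpolys n"
    using S.boundary_set_closed[of B "map indexed_var is @ ys"] assms(1) by simp
  obtain k u a where t: "t = indexed_var i [^]\<^bsub>mpoly_ring R n\<^esub> (k::nat) \<otimes>\<^bsub>mpoly_ring R n\<^esub>
      (u \<oplus>\<^bsub>mpoly_ring R n\<^esub> a \<otimes>\<^bsub>mpoly_ring R n\<^esub> indexed_var i)"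
    "u \<in> ?T" "a \<in> carrier (mpoly_ring R n)"
    using Cons.prems(3) unfolding list.map append_Cons boundary_set.simps by blast
  from Cons.IH[OF _ _ t(2)] Cons.prems obtain s m where s: "s \<in> boundary_set (mpoly_ring R n) B ys"
    "set_mset m \<subseteq> set is" "u m = s {#}" by auto
  have u: "u \<in> carrier (mpoly_ring R n)" and a: "a \<in> mpolys n" using t T by auto
  have X: "indexed_var i \<in> carrier (mpoly_ring R n)" using indexed_var_mpolys[OF i] by simp
  let ?v = "u \<oplus>\<^bsub>mpoly_ring R n\<^esub> a \<otimes>\<^bsub>mpoly_ring R n\<^esub> indexed_var i"
  have "?v \<in> carrier (mpoly_ring R n)"
    using u X t(3) by (simp del: mpoly_ring_simps)
  then have "t (replicate_mset k i + m) = ?v m"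
    unfolding t(1) by (intro indexed_var_pow_coeff i) simp
  also have "a \<otimes>\<^bsub>mpoly_ring R n\<^esub> indexed_var i = indexed_pmult a i"
    using S.m_comm[OF t(3) X] cauchy_indexed_var[OF a] by simp
  then have "?v m = u m \<oplus> indexed_pmult a i m" by (simp add: indexed_padd_def)
  also have "\<dots> = u m"
    using s(2) dist carrier_coeffE[OF mpolys_coeff, of u n m] u by (auto simp: indexed_pmult_def)
  finally have "t (replicate_mset k i + m) = s {#}" using s by simp
  moreover have "set_mset (replicate_mset k i + m) \<subseteq> set (i # is)" using s(2) by auto
  ultimately show ?case using s(1) by blast
qed

section \<open>Constant coefficients and descent of the absolute dimension to
  \<open>R\<close>\<close>

lemma const_coeff_ring_hom_cring: "ring_hom_cring (mpoly_ring R n) R (\<lambda>p. p {#})"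
proof (intro ring_hom_cring.intro ring_hom_cring_axioms.intro mpoly_cring is_cring ring_hom_memI)
  fix p q assume "p \<in> carrier (mpoly_ring R n)" "q \<in> carrier (mpoly_ring R n)"
  then have c: "p {#} \<in> carrier R" "q {#} \<in> carrier R" using carrier_coeffE mpolys_coeff by auto
  then show "p {#} \<in> carrier R" by simp
  show "(p \<oplus>\<^bsub>mpoly_ring R n\<^esub> q) {#} = p {#} \<oplus> q {#}" by (simp add: indexed_padd_def)
  show "(p \<otimes>\<^bsub>mpoly_ring R n\<^esub> q) {#} = p {#} \<otimes> q {#}"
    using c by (simp add: cauchy_def)
qed (simp add: indexed_const_def)

lemma krull_dim_le_of_mpoly_ring:
  assumes r: "r \<ge> -1" and dim: "krull_dim_le (mpoly_ring R n) (r + int n)"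
  shows "krull_dim_le R r"
proof -
  let ?S = "mpoly_ring R n"
  interpret S: cring ?S by (rule mpoly_cring)
  interpret C: ring_hom_cring ?S R "\<lambda>p. p {#}" by (rule const_coeff_ring_hom_cring)
  \<comment> \<open>This serves r = -1 as well: then the list is empty, and 0 being an element of
    {1} says that \<open>R\<close> is trivial.\<close>
  have zero: "\<zero> \<in> boundary_set R {\<one>} xs" if xs: "set xs \<subseteq> carrier R" "int (length xs) = r + 1" for xs
  proof (cases "r + int n = -1")
    case True
    \<comment> \<open>Here r = -1 and n = 0, and the dimension hypothesis means triviality instead
      of collapses.\<close>
    then have "\<one>\<^bsub>?S\<^esub> = \<zero>\<^bsub>?S\<^esub>" using dim by (simp add: krull_dim_le_def del: mpoly_ring_simps)
    then have "\<one> = \<zero>" using C.hom_one C.hom_zero by metis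
    moreover have "r = -1" using True r by linarith
    ultimately show ?thesis using xs(2) by simp
  next
    case False
    \<comment> \<open>The variables stand outermost, so that \<open>boundary_set_vars_coeff\<close>
      strips them and leaves the constants.\<close>
    define zs :: "(nat multiset \<Rightarrow> 'a) list" where "zs = map indexed_var [Suc 0..<Suc n] @ map indexed_const xs"
    have cs: "set (map indexed_const xs) \<subseteq> carrier ?S" using xs(1) indexed_pset.indexed_const by auto
    have vars: "set (map indexed_var [Suc 0..<Suc n]) \<subseteq> carrier ?S"
      using indexed_var_mpolys by auto
    have zs: "set zs \<subseteq> carrier ?S" "int (length zs) = r + int n + 1"
      using cs vars xs(2) by (auto simp: zs_def simp del: mpoly_ring_simps)
    have "\<forall>zs. set zs \<subseteq> carrier ?S \<and> int (length zs) = r + int n + 1 \<longrightarrow>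
        collapses ?S (elementary_chain ?S zs)"
      using dim False unfolding krull_dim_le_def by blast
    from this[rule_format, OF conjI[OF zs]] have "collapses ?S (elementary_chain ?S zs)" .
    then have z: "\<zero>\<^bsub>?S\<^esub> \<in> boundary_set ?S {\<one>\<^bsub>?S\<^esub>} zs"
      by (rule S.collapses_elementary_iff[OF zs(1), THEN iffD1])
    have "{\<one>\<^bsub>?S\<^esub>} \<subseteq> mpolys n" using S.one_closed by simp
    moreover have "set (map indexed_const xs) \<subseteq> mpolys n" using cs by simp
    moreover have "set [Suc 0..<Suc n] \<subseteq> {Suc 0..n}" by auto
    ultimately have "\<exists>s\<in>boundary_set ?S {\<one>\<^bsub>?S\<^esub>} (map indexed_const xs).
        \<exists>m. set_mset m \<subseteq> set [Suc 0..<Suc n] \<and> \<zero>\<^bsub>?S\<^esub> m = s {#}"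
      using z unfolding zs_def by (intro boundary_set_vars_coeff distinct_upt)
    then obtain s m where s: "s \<in> boundary_set ?S {\<one>\<^bsub>?S\<^esub>} (map indexed_const xs)" "\<zero>\<^bsub>?S\<^esub> m = s {#}"
      by blast
    \<comment> \<open>Setting all variables to 0 undoes the embedding of \<open>xs\<close> and
      carries the remaining relation back to \<open>R\<close>.\<close>
    have "s {#} \<in> boundary_set R ((\<lambda>p. p {#}) ` {\<one>\<^bsub>?S\<^esub>}) (map (\<lambda>p :: nat multiset \<Rightarrow> 'a. p {#}) (map indexed_const xs))"
      by (rule C.boundary_set_hom[OF _ cs s(1)]) (simp add: S.one_closed del: mpoly_ring_simps)
    moreover have "map (\<lambda>p :: nat multiset \<Rightarrow> 'a. p {#}) (map indexed_const xs) = xs"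
      by (simp add: o_def indexed_const_def)
    moreover have "s {#} = \<zero>" using s(2) by (simp add: indexed_const_def)
    ultimately show ?thesis by (simp add: indexed_const_def)
  qed
  show ?thesis
  proof (cases "r = -1")
    case True
    then show ?thesis using zero[of "[]"] by (simp add: krull_dim_le_def)
  next
    case False
    then have "r \<ge> 0" using r by linarith
    moreover have "collapses R (elementary_chain R xs)"
      if "set xs \<subseteq> carrier R" "int (length xs) = r + 1" for xs
      using zero[OF that] collapses_elementary_iff[OF that(1)] by simp
    ultimately show ?thesis by (simp add: krull_dim_le_def)
  qed
qed

section \<open>Lower bound for the relative dimension\<close>

lemma ideal_coeffs:
  assumes "ideal P R"
  shows "ideal {p \<in> mpolys n. \<forall>m. p m \<in> P} (mpoly_ring R n)"
proof -
  let ?S = "mpoly_ring R n" and ?J = "{p \<in> mpolys n. \<forall>m. p m \<in> P}"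
  interpret S: cring ?S by (rule mpoly_cring)
  interpret P: ideal P R by fact
  have mult: "q \<otimes>\<^bsub>?S\<^esub> p \<in> ?J" if p: "p \<in> ?J" and q: "q \<in> mpolys n" for p q
  proof -
    have c: "carrier_coeff p" using p mpolys_coeff by blast
    have "\<forall>m. cauchy q p m \<in> P"
      using q
    proof induction
      case (indexed_const a)
      then show ?case using p c by (simp add: cauchy_indexed_const P.I_l_closed)
    next
      case (indexed_padd q q')
      then show ?case using c p by (simp add: cauchy_indexed_padd mpolys_coeff) (simp add: indexed_padd_def P.a_closed)
    next
      case (indexed_pmult q i)
      then show ?case using c p by (simp add: cauchy_indexed_pmult mpolys_coeff) (simp add: indexed_pmult_def P.zero_closed)
    qed
    then show ?thesis using cauchy_closed[OF q] p by simp
  qed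
  show ?thesis
  proof (rule idealI[OF S.ring_axioms])
    show "subgroup ?J (add_monoid ?S)"
    proof (rule subgroup.intro)
      show "?J \<subseteq> carrier (add_monoid ?S)" by auto
      show "\<one>\<^bsub>add_monoid ?S\<^esub> \<in> ?J"
        using S.zero_closed P.zero_closed by (simp add: indexed_const_def)
    next
      fix p q assume "p \<in> ?J" "q \<in> ?J"
      then show "p \<otimes>\<^bsub>add_monoid ?S\<^esub> q \<in> ?J"
        by (simp add: indexed_pset.indexed_padd) (simp add: indexed_padd_def P.a_closed)
    next
      fix p assume p: "p \<in> ?J"
      then have "p \<in> carrier ?S" by simp
      then have eq: "inv\<^bsub>add_monoid ?S\<^esub> p = \<ominus>\<^bsub>?S\<^esub> \<one>\<^bsub>?S\<^esub> \<otimes>\<^bsub>?S\<^esub> p"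
        unfolding a_inv_def[symmetric] by (simp add: S.l_minus del: mpoly_ring_simps)
      have "\<ominus>\<^bsub>?S\<^esub> \<one>\<^bsub>?S\<^esub> \<in> mpolys n" using S.a_inv_closed[OF S.one_closed] by simp
      then show "inv\<^bsub>add_monoid ?S\<^esub> p \<in> ?J" unfolding eq by (rule mult[OF p])
    qed
    fix p q assume pq: "p \<in> ?J" "q \<in> carrier ?S"
    have q: "q \<in> mpolys n" using pq(2) by simp
    have p: "p \<in> carrier ?S" using pq(1) by simp
    show "q \<otimes>\<^bsub>?S\<^esub> p \<in> ?J" by (rule mult[OF pq(1) q])
    then show "p \<otimes>\<^bsub>?S\<^esub> q \<in> ?J" unfolding S.m_comm[OF p pq(2)] .
  qed
qed

text \<open>The variables themselves do not collapse. A prime \<open>P\<close> of \<open>R\<close>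
  decides which constants are declared zero. If t + j = 0, some coefficient of t is the constant
  coefficient of a product of constants outside \<open>P\<close>, so it is outside \<open>P\<close>,
  whereas all coefficients of j lie in \<open>P\<close>.\<close>

lemma rel_krull_dim_ge_mpoly_ring:
  assumes "\<one> \<noteq> \<zero>"
  shows "rel_krull_dim_ge (mpoly_ring R n) (mpoly_consts R) n"
proof -
  let ?S = "mpoly_ring R n"
  interpret S: cring ?S by (rule mpoly_cring)
  interpret C: ring_hom_cring ?S R "\<lambda>p. p {#}" by (rule const_coeff_ring_hom_cring)
  obtain P where P: "primeideal P R"
    using exists_primeideal_disjoint[OF zeroideal, of "{\<one>}"] assms by auto
  interpret P: primeideal P R by (rule P)
  \<comment> \<open>Being prime, \<open>Q\<close> is avoided not only by the constants declared
    invertible but by the whole monoid they generate.\<close>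
  define Q where "Q = {p \<in> carrier ?S. p {#} \<in> P}"
  have Q: "primeideal Q ?S"
    unfolding Q_def by (rule C.ring.primeideal_vimage[OF S.is_cring P])
  let ?xs = "map indexed_var [Suc 0..<Suc n] :: (nat multiset \<Rightarrow> 'a) list"
  have xs: "set ?xs \<subseteq> carrier ?S" using indexed_var_mpolys by auto
  have "\<not> collapses_above ?S (mpoly_consts R) (elementary_chain ?S ?xs)"
  proof
    assume "collapses_above ?S (mpoly_consts R) (elementary_chain ?S ?xs)"
    then obtain as where as: "set as \<subseteq> mpoly_consts R" and coll:
      "\<forall>H H'. H \<union> H' = {..<length as} \<and> H \<inter> H' = {} \<longrightarrow>
      collapses ?S (adjoin_last ((!) as ` H') (adjoin_first ((!) as ` H) (elementary_chain ?S ?xs)))"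
      unfolding collapses_above_def by (elim exE conjE)
    define H where "H = {i. i < length as \<and> (as ! i) {#} \<in> P}"
    define H' where "H' = {i. i < length as \<and> (as ! i) {#} \<notin> P}"
    let ?A = "(!) as ` H" and ?V = "(!) as ` H'"
    have AK: "?A \<subseteq> mpoly_consts R" "?V \<subseteq> mpoly_consts R"
      using as by (force simp: H_def H'_def)+
    have "mpoly_consts R \<subseteq> carrier ?S" unfolding mpoly_consts_def using indexed_pset.indexed_const by auto
    then have car: "?A \<subseteq> carrier ?S" "?V \<subseteq> carrier ?S" using AK by blast+
    have HH: "H \<union> H' = {..<length as} \<and> H \<inter> H' = {}" by (auto simp: H_def H'_def)
    let ?M = "monoid_generated ?S (insert \<one>\<^bsub>?S\<^esub> ?V)"
    from coll[rule_format, OF HH] obtain t j where t: "t \<in> boundary_set ?S ?M ?xs"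
      and j: "j \<in> Idl\<^bsub>?S\<^esub> (?A \<union> {\<zero>\<^bsub>?S\<^esub>})" and tj: "t \<oplus>\<^bsub>?S\<^esub> j = \<zero>\<^bsub>?S\<^esub>"
      unfolding S.collapses_adjoined_elementary_iff[OF car xs] by blast
    have ins: "insert \<one>\<^bsub>?S\<^esub> ?V \<subseteq> carrier ?S" using car S.one_closed by blast
    have "\<one> \<notin> P" using P.I_notcarr P.one_imp_carrier by auto
    then have "insert \<one>\<^bsub>?S\<^esub> ?V \<inter> Q = {}"
      by (auto simp: Q_def H'_def indexed_const_def)
    then have "?M \<inter> Q = {}" by (rule S.monoid_generated_disjoint_prime[OF Q ins])
    have M: "?M \<subseteq> mpolys n" using S.monoid_generated_closed[OF ins] unfolding mpoly_ring_simps(1) .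
    have "set [Suc 0..<Suc n] \<subseteq> {Suc 0..n}" by auto
    moreover have "t \<in> boundary_set ?S ?M (?xs @ [])" using t by (simp only: append_Nil2)
    ultimately have "\<exists>s\<in>boundary_set ?S ?M []. \<exists>m. set_mset m \<subseteq> set [Suc 0..<Suc n] \<and> t m = s {#}"
      using M by (intro boundary_set_vars_coeff distinct_upt) simp_all
    then obtain s m where s: "s \<in> ?M" "t m = s {#}" by (simp only: boundary_set.simps) blast
    then have "t m \<notin> P" using \<open>?M \<inter> Q = {}\<close> M by (auto simp: Q_def)
    \<comment> \<open>The monomial \<open>m\<close> is dictated by t, so every coefficient of the
      elements of this ideal has to be controlled.\<close>
    have "Idl\<^bsub>?S\<^esub> (?A \<union> {\<zero>\<^bsub>?S\<^esub>}) \<subseteq> {p \<in> mpolys n. \<forall>m. p m \<in> P}"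
    proof (rule S.genideal_minimal[OF ideal_coeffs[OF P.is_ideal]], rule subsetI)
      fix p assume p: "p \<in> ?A \<union> {\<zero>\<^bsub>?S\<^esub>}"
      then have "p \<in> mpolys n" using car S.zero_closed by auto
      moreover have "p m \<in> P" for m
      proof (cases "p \<in> ?A")
        case True
        then have "p {#} \<in> P" by (auto simp: H_def)
        moreover obtain a where "p = indexed_const a" using AK True by (auto simp: mpoly_consts_def)
        ultimately show ?thesis using P.zero_closed by (simp add: indexed_const_def)
      qed (use p P.zero_closed in \<open>auto simp: indexed_const_def\<close>)
      ultimately show "p \<in> {p \<in> mpolys n. \<forall>m. p m \<in> P}" by blast
    qed
    then have jP: "j m \<in> P" using j by blast
    have "t \<in> mpolys n" using t S.boundary_set_closed[OF _ xs, of ?M] M by auto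
    then have tm: "t m \<in> carrier R" using carrier_coeffE mpolys_coeff by blast
    have "(t \<oplus>\<^bsub>?S\<^esub> j) m = \<zero>" unfolding tj by (simp add: indexed_const_def)
    then have "t m \<oplus> j m = \<zero>" by (simp add: indexed_padd_def)
    then have "t m = \<ominus> (j m)" using tm P.Icarr[OF jP] minus_equality by metis
    then show False using \<open>t m \<notin> P\<close> P.a_inv_closed[OF jP] by simp
  qed
  then show ?thesis
    unfolding rel_krull_dim_ge_def using xs by (intro exI[of _ ?xs]) simp
qed

end

section \<open>Homogeneous linear systems\<close>

context cring
begin

lemma monoid_generated_mono: "U \<subseteq> V \<Longrightarrow> monoid_generated R U \<subseteq> monoid_generated R V"
proof
  fix x assume "x \<in> monoid_generated R U" "U \<subseteq> V"
  then show "x \<in> monoid_generated R V" by induction (auto intro: monoid_generated.intros)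
qed

lemma finsum_ideal:
  assumes "ideal I R" "\<And>e. e \<in> E \<Longrightarrow> f e \<in> I"
  shows "finsum R f E \<in> I"
proof -
  interpret ideal I R by fact
  show ?thesis
    using assms(2)
  proof (induction E rule: infinite_finite_induct)
    case (insert e E)
    have "f \<in> E \<rightarrow> carrier R" "f e \<in> carrier R" using insert.prems Icarr by auto
    then show ?case using insert by (simp add: finsum_insert a_closed)
  qed auto
qed

text \<open>Gaussian elimination without fractions, all branches at once: each element of \<open>F\<close> may be
  declared zero (put into \<open>H\<close>) or invertible, and the solution never leaves \<open>F\<close>.\<close>

lemma homogeneous_system_solution:
  assumes "finite I" "finite E" "card I < card E" "\<And>e i. v e i \<in> carrier R"
  shows "\<exists>F. finite F \<and> F \<subseteq> carrier R \<and> (\<forall>H\<subseteq>F. \<exists>c. (\<forall>e\<in>E. c e \<in> F) \<and>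
    (\<exists>e\<in>E. c e \<in> monoid_generated R (F - H)) \<and> (\<forall>i\<in>I. (\<Oplus>e\<in>E. c e \<otimes> v e i) \<in> Idl H))"
  using assms
proof (induction I arbitrary: E v rule: finite_induct)
  case empty
  then obtain e0 where e0: "e0 \<in> E" by fastforce
  \<comment> \<open>Without equations a unit vector is a solution, and its entry 1 lies in every
    monoid, whatever \<open>H\<close> is.\<close>
  show ?case
    using e0
    by (intro exI[of _ "{\<zero>, \<one>}"])
      (auto intro!: exI[of _ "\<lambda>e. if e = e0 then \<one> else \<zero>"] bexI[of _ e0] monoid_generated.one)
next
  case (insert i0 I)
  note fin = \<open>finite E\<close> and v = insert.prems(3)
  have card: "card I < card E" "\<And>e. e \<in> E \<Longrightarrow> card I < card (E - {e})"
    using insert by auto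
  obtain F0 where F0: "finite F0" "F0 \<subseteq> carrier R"
    and F0_sol: "\<And>H. H \<subseteq> F0 \<Longrightarrow> \<exists>c. (\<forall>e\<in>E. c e \<in> F0) \<and>
      (\<exists>e\<in>E. c e \<in> monoid_generated R (F0 - H)) \<and> (\<forall>i\<in>I. (\<Oplus>e\<in>E. c e \<otimes> v e i) \<in> Idl H)"
  proof -
    have "\<exists>F. finite F \<and> F \<subseteq> carrier R \<and> (\<forall>H\<subseteq>F. \<exists>c. (\<forall>e\<in>E. c e \<in> F) \<and>
      (\<exists>e\<in>E. c e \<in> monoid_generated R (F - H)) \<and> (\<forall>i\<in>I. (\<Oplus>e\<in>E. c e \<otimes> v e i) \<in> Idl H))"
      by (rule insert.IH[OF fin card(1) v])
    then show ?thesis using that by (elim exE conjE) simp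
  qed
  \<comment> \<open>The 2 x 2 minors at the pivot \<open>v e0 i0\<close>. They vanish for i = i0 and
    are the coefficients of the system after eliminating the unknown \<open>e0\<close>.\<close>
  define w where "w e0 e i = v e0 i0 \<otimes> v e i \<oplus> \<ominus> (v e i0 \<otimes> v e0 i)" for e0 e i
  have w: "w e0 e i \<in> carrier R" for e0 e i by (simp add: w_def v)
  define sol where "sol e0 F \<longleftrightarrow> finite F \<and> F \<subseteq> carrier R \<and>
      (\<forall>H\<subseteq>F. \<exists>c. (\<forall>e\<in>E - {e0}. c e \<in> F) \<and>
      (\<exists>e\<in>E - {e0}. c e \<in> monoid_generated R (F - H)) \<and>
      (\<forall>i\<in>I. (\<Oplus>e\<in>E - {e0}. c e \<otimes> w e0 e i) \<in> Idl H))" for e0 F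
  have "\<exists>F. sol e0 F" if "e0 \<in> E" for e0
    unfolding sol_def by (rule insert.IH[OF _ card(2)[OF that] w]) (simp add: fin)
  then have "\<forall>e0\<in>E. \<exists>F. sol e0 F" by blast
  from bchoice[OF this] obtain F1 where sol: "\<forall>e0\<in>E. sol e0 (F1 e0)" ..
  then have F1: "\<And>e0. e0 \<in> E \<Longrightarrow> finite (F1 e0) \<and> F1 e0 \<subseteq> carrier R"
    by (simp add: sol_def)
  have F1_sol: "\<exists>c. (\<forall>e\<in>E - {e0}. c e \<in> F1 e0) \<and>
      (\<exists>e\<in>E - {e0}. c e \<in> monoid_generated R (F1 e0 - H)) \<and>
      (\<forall>i\<in>I. (\<Oplus>e\<in>E - {e0}. c e \<otimes> w e0 e i) \<in> Idl H)" if "e0 \<in> E" "H \<subseteq> F1 e0" for e0 H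
    using bspec[OF sol that(1)] that(2) unfolding sol_def by simp
  \<comment> \<open>A solution of the reduced system is lifted by multiplying it with the pivot;
    this value of the unknown \<open>e0\<close> then makes equation \<open>i0\<close> hold.\<close>
  define s where "s e0 c = (\<Oplus>e\<in>E - {e0}. \<ominus> (c e) \<otimes> v e i0)" for e0 c
  \<comment> \<open>All coefficients of lifted solutions, for every function \<open>c\<close> with
    values in \<open>F1 e0\<close>, since \<open>c\<close> will depend on \<open>H\<close>. There
    are finitely many.\<close>
  define G where "G e0 = (\<lambda>f. v e0 i0 \<otimes> f) ` F1 e0 \<union> s e0 ` PiE (E - {e0}) (\<lambda>_. F1 e0)" for e0
  have G: "finite (G e0) \<and> G e0 \<subseteq> carrier R" if "e0 \<in> E" for e0
  proof
    show "finite (G e0)" unfolding G_def using F1[OF that] fin by (intro finite_UnI finite_imageI finite_PiE) auto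
    have "s e0 c \<in> carrier R" if "c \<in> PiE (E - {e0}) (\<lambda>_. F1 e0)" for c
      unfolding s_def using that F1[OF \<open>e0 \<in> E\<close>] v by (intro finsum_closed) blast
    then show "G e0 \<subseteq> carrier R" unfolding G_def using F1[OF that] v by auto
  qed
  define F where "F = F0 \<union> (\<lambda>e. v e i0) ` E \<union> (\<Union>e0\<in>E. F1 e0 \<union> G e0)"
  have "F1 e0 \<union> G e0 \<subseteq> carrier R" if "e0 \<in> E" for e0 using F1[OF that] G[OF that] by blast
  then have F: "finite F" "F \<subseteq> carrier R"
    unfolding F_def using F0 F1 G fin v by blast+
  have sub: "F0 \<subseteq> F" "\<And>e. e \<in> E \<Longrightarrow> v e i0 \<in> F" "\<And>e0. e0 \<in> E \<Longrightarrow> F1 e0 \<subseteq> F" "\<And>e0. e0 \<in> E \<Longrightarrow> G e0 \<subseteq> F"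
    unfolding F_def by blast+
  have "\<exists>c. (\<forall>e\<in>E. c e \<in> F) \<and> (\<exists>e\<in>E. c e \<in> monoid_generated R (F - H)) \<and>
      (\<forall>i\<in>insert i0 I. (\<Oplus>e\<in>E. c e \<otimes> v e i) \<in> Idl H)" if H: "H \<subseteq> F" for H
  proof -
    have Hc: "H \<subseteq> carrier R" using H F by blast
    interpret IH: ideal "Idl H" R by (rule genideal_ideal[OF Hc])
    have Idl_mono: "Idl (H \<inter> F') \<subseteq> Idl H" for F' by (rule subset_Idl_subset[OF Hc]) blast
    \<comment> \<open>If all coefficients of equation \<open>i0\<close> are declared zero, that
      equation holds modulo \<open>H\<close> by itself; otherwise a coefficient outside
      \<open>H\<close> counts as invertible and becomes the pivot.\<close>
    show ?thesis
    proof (cases "\<forall>e\<in>E. v e i0 \<in> H")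
      case True
      obtain c where c: "\<forall>e\<in>E. c e \<in> F0" "\<exists>e\<in>E. c e \<in> monoid_generated R (F0 - H \<inter> F0)"
        "\<forall>i\<in>I. (\<Oplus>e\<in>E. c e \<otimes> v e i) \<in> Idl (H \<inter> F0)"
        using F0_sol[of "H \<inter> F0"] by auto
      have "(\<Oplus>e\<in>E. c e \<otimes> v e i0) \<in> Idl H"
      proof (rule finsum_ideal[OF IH.is_ideal])
        fix e assume "e \<in> E"
        then show "c e \<otimes> v e i0 \<in> Idl H"
          using True c(1) F0(2) genideal_self[OF Hc] by (intro IH.I_l_closed) auto
      qed
      moreover have "monoid_generated R (F0 - H \<inter> F0) \<subseteq> monoid_generated R (F - H)"
        using sub(1) by (intro monoid_generated_mono) blast
      ultimately show ?thesis
        using c sub(1) Idl_mono by (intro exI[of _ c]) blast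
    next
      case False
      then obtain e0 where e0: "e0 \<in> E" "v e0 i0 \<notin> H" by blast
      let ?E = "E - {e0}" and ?a = "v e0 i0"
      obtain c where c: "\<forall>e\<in>?E. c e \<in> F1 e0" "\<exists>e\<in>?E. c e \<in> monoid_generated R (F1 e0 - H \<inter> F1 e0)"
        "\<forall>i\<in>I. (\<Oplus>e\<in>?E. c e \<otimes> w e0 e i) \<in> Idl (H \<inter> F1 e0)"
        using F1_sol[of e0 "H \<inter> F1 e0"] e0 by auto
      have cc: "c e \<in> carrier R" if "e \<in> ?E" for e using c(1) F1[OF e0(1)] that by blast
      define d where "d e = (if e = e0 then s e0 c else ?a \<otimes> c e)" for e
      \<comment> \<open>Members of \<open>PiE\<close> are undefined off the index set, so
        \<open>c\<close> is restricted to fit; the sum is unchanged.\<close>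
      have "s e0 c = s e0 (restrict c ?E)"
        unfolding s_def by (rule finsum_cong') (use cc v in auto)
      moreover have "restrict c ?E \<in> PiE ?E (\<lambda>_. F1 e0)" using c(1) by auto
      ultimately have "s e0 c \<in> G e0" unfolding G_def by blast
      moreover have "?a \<otimes> c e \<in> G e0" if "e \<in> ?E" for e unfolding G_def using c(1) that by blast
      ultimately have dF: "\<forall>e\<in>E. d e \<in> F" using sub(4)[OF e0(1)] unfolding d_def by auto
      obtain e1 where e1: "e1 \<in> ?E" "c e1 \<in> monoid_generated R (F1 e0 - H \<inter> F1 e0)" using c(2) by blast
      have "monoid_generated R (F1 e0 - H \<inter> F1 e0) \<subseteq> monoid_generated R (F - H)"
        using sub(3)[OF e0(1)] by (intro monoid_generated_mono) blast
      moreover have "?a \<in> F - H" using e0 sub(2) by blast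
      ultimately have "d e1 \<in> monoid_generated R (F - H)"
        unfolding d_def using e1 monoid_generated.prod[OF monoid_generated.incl[of ?a "F - H"], of "c e1"] by auto
      moreover have sum: "(\<Oplus>e\<in>E. d e \<otimes> v e i) = (\<Oplus>e\<in>?E. c e \<otimes> w e0 e i)" for i
      proof -
        have sc: "s e0 c \<in> carrier R" unfolding s_def by (intro finsum_closed) (use cc v in auto)
        have "(\<Oplus>e\<in>E. d e \<otimes> v e i) = (\<Oplus>e\<in>insert e0 ?E. d e \<otimes> v e i)"
          using e0 by (simp add: insert_absorb)
        also have "\<dots> = d e0 \<otimes> v e0 i \<oplus> (\<Oplus>e\<in>?E. d e \<otimes> v e i)"
          by (rule finsum_insert) (use fin cc v sc in \<open>auto simp: d_def\<close>)
        also have "d e0 \<otimes> v e0 i = (\<Oplus>e\<in>?E. (\<ominus> (c e) \<otimes> v e i0) \<otimes> v e0 i)"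
          unfolding d_def s_def by (simp, rule finsum_ldistr) (use fin cc v in auto)
        also have "(\<Oplus>e\<in>?E. d e \<otimes> v e i) = (\<Oplus>e\<in>?E. ?a \<otimes> c e \<otimes> v e i)"
          by (rule finsum_cong') (use cc v in \<open>auto simp: d_def\<close>)
        also have "(\<Oplus>e\<in>?E. (\<ominus> (c e) \<otimes> v e i0) \<otimes> v e0 i) \<oplus> (\<Oplus>e\<in>?E. ?a \<otimes> c e \<otimes> v e i) =
            (\<Oplus>e\<in>?E. (\<ominus> (c e) \<otimes> v e i0) \<otimes> v e0 i \<oplus> ?a \<otimes> c e \<otimes> v e i)"
          by (rule finsum_addf[symmetric]) (use cc v in auto)
        also have "\<dots> = (\<Oplus>e\<in>?E. c e \<otimes> w e0 e i)"
        proof (rule finsum_cong')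
          fix e assume "e \<in> ?E"
          then have "c e \<in> carrier R" by (rule cc)
          then show "(\<ominus> (c e) \<otimes> v e i0) \<otimes> v e0 i \<oplus> ?a \<otimes> c e \<otimes> v e i = c e \<otimes> w e0 e i"
            using v[of e i0] v[of e0 i] v[of e0 i0] v[of e i] unfolding w_def by algebra
        qed (use cc w in auto)
        finally show ?thesis .
      qed
      moreover have "(\<Oplus>e\<in>?E. c e \<otimes> w e0 e i0) = (\<Oplus>e\<in>?E. \<zero>)"
      proof (rule finsum_cong')
        fix e assume "e \<in> ?E"
        have "w e0 e i0 = \<zero>" using v[of e0 i0] v[of e i0] unfolding w_def by algebra
        then show "c e \<otimes> w e0 e i0 = \<zero>" using cc[OF \<open>e \<in> ?E\<close>] by simp
      qed auto
      then have "(\<Oplus>e\<in>E. d e \<otimes> v e i0) \<in> Idl H" unfolding sum using IH.zero_closed by simp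
      ultimately show ?thesis
        using dF e1(1) c(3) Idl_mono[of "F1 e0"] by (intro exI[of _ d]) auto
    qed
  qed
  then show ?case using F by blast
qed

end

section \<open>Leading terms\<close>

primrec power_prod :: "('a, 'm) ring_scheme \<Rightarrow> 'a list \<Rightarrow> nat list \<Rightarrow> 'a" where
  "power_prod R [] ks = \<one>\<^bsub>R\<^esub>"
| "power_prod R (x # xs) ks = x [^]\<^bsub>R\<^esub> hd ks \<otimes>\<^bsub>R\<^esub> power_prod R xs (tl ks)"

text \<open>The elements of the boundary set with prescribed exponents \<open>ks\<close> and innermost element \<open>c\<close>:
  those which can be written as \<open>c x\<^bsup>ks\<^esup>\<close> plus lexicographically larger terms.\<close>

primrec leading_set :: "('a, 'm) ring_scheme \<Rightarrow> 'a \<Rightarrow> 'a list \<Rightarrow> nat list \<Rightarrow> 'a set" where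
  "leading_set R c [] ks = {c}"
| "leading_set R c (x # xs) ks =
     {x [^]\<^bsub>R\<^esub> hd ks \<otimes>\<^bsub>R\<^esub> (t \<oplus>\<^bsub>R\<^esub> a \<otimes>\<^bsub>R\<^esub> x) | t a. t \<in> leading_set R c xs (tl ks) \<and> a \<in> carrier R}"

lemma lex_less_than_linear:
  "length ks = length ls \<Longrightarrow> ks \<noteq> ls \<Longrightarrow> (ks, ls) \<in> lex less_than \<or> (ls, ks) \<in> lex less_than"
  by (induction ks ls rule: list_induct2) auto

context cring
begin

lemma power_prod_closed: "set xs \<subseteq> carrier R \<Longrightarrow> power_prod R xs ks \<in> carrier R"
  by (induction xs arbitrary: ks) auto

lemma leading_set_subset_boundary_set:
  "c \<in> B \<Longrightarrow> leading_set R c xs ks \<subseteq> boundary_set R B xs"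
proof (induction xs arbitrary: ks)
  case (Cons x xs)
  have "leading_set R c xs (tl ks) \<subseteq> boundary_set R B xs" by (rule Cons.IH[OF Cons.prems])
  then show ?case unfolding leading_set.simps boundary_set.simps by blast
qed simp

lemma leading_set_closed:
  assumes "c \<in> carrier R" "set xs \<subseteq> carrier R"
  shows "leading_set R c xs ks \<subseteq> carrier R"
proof -
  have "leading_set R c xs ks \<subseteq> boundary_set R {c} xs" by (rule leading_set_subset_boundary_set) simp
  moreover have "\<dots> \<subseteq> carrier R" using assms by (intro boundary_set_closed) auto
  ultimately show ?thesis by blast
qed

lemma leading_set_ConsI:
  assumes "t \<in> leading_set R c xs ks" "a \<in> carrier R"
  shows "x [^] k \<otimes> (t \<oplus> a \<otimes> x) \<in> leading_set R c (x # xs) (k # ks)"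
  unfolding leading_set.simps list.sel using assms by blast

lemma leading_term_in_leading_set:
  assumes "c \<in> carrier R" "set xs \<subseteq> carrier R" "length ks = length xs"
  shows "c \<otimes> power_prod R xs ks \<in> leading_set R c xs ks"
  using assms(2,3)
proof (induction xs arbitrary: ks)
  case (Cons x xs)
  then obtain k ks' where ks: "ks = k # ks'" "length ks' = length xs" by (cases ks) auto
  let ?p = "power_prod R xs ks'"
  have x: "x \<in> carrier R" and p: "?p \<in> carrier R" using Cons.prems power_prod_closed by auto
  have "c \<otimes> ?p \<in> leading_set R c xs ks'" using Cons ks by simp
  from leading_set_ConsI[OF this zero_closed]
  have "x [^] k \<otimes> (c \<otimes> ?p \<oplus> \<zero> \<otimes> x) \<in> leading_set R c (x # xs) ks" unfolding ks(1) .
  also have "x [^] k \<otimes> (c \<otimes> ?p \<oplus> \<zero> \<otimes> x) = c \<otimes> power_prod R (x # xs) ks"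
    using x p assms(1) unfolding ks(1) by (simp add: m_lcomm)
  finally show ?case .
qed (use assms in auto)

text \<open>If the first exponents differ, the new term is divisible by x^(k+1) and disappears in
  the free coefficient \<open>a\<close>; if they agree, it moves into the bracket, where the
  remaining exponents are compared.\<close>

lemma leading_set_add_greater:
  assumes "c \<in> carrier R" "b \<in> carrier R" "set xs \<subseteq> carrier R"
    and "length ks = length xs" "length ls = length xs" "(ks, ls) \<in> lex less_than"
    and "t \<in> leading_set R c xs ks"
  shows "t \<oplus> b \<otimes> power_prod R xs ls \<in> leading_set R c xs ks"
  using assms(3-7)
proof (induction xs arbitrary: ks ls t)
  case (Cons x xs)
  from Cons.prems obtain k ks' where ks: "ks = k # ks'" "length ks' = length xs" by (cases ks) auto
  from Cons.prems obtain l ls' where ls: "ls = l # ls'" "length ls' = length xs" by (cases ls) auto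
  let ?p = "power_prod R xs ls'"
  have x: "x \<in> carrier R" and xs: "set xs \<subseteq> carrier R" and p: "?p \<in> carrier R"
    using Cons.prems power_prod_closed by auto
  obtain s a where t: "t = x [^] k \<otimes> (s \<oplus> a \<otimes> x)" and s: "s \<in> leading_set R c xs ks'" and a: "a \<in> carrier R"
    using Cons.prems(5) unfolding ks(1) leading_set.simps list.sel by blast
  have sc: "s \<in> carrier R" using s leading_set_closed[OF assms(1) xs] by blast
  have xk: "x [^] k \<in> carrier R" using x by simp
  consider "k < l" | "k = l" "(ks', ls') \<in> lex less_than"
    using Cons.prems(4) unfolding ks(1) ls(1) by auto
  then show ?case
  proof cases
    case 1
    \<comment> \<open>The cofactor in x^l = x^k z x.\<close>
    define z where "z = x [^] (l - Suc k)"
    have z: "z \<in> carrier R" using x by (simp add: z_def)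
    have "x [^] l = x [^] (k + (l - Suc k) + 1)" using 1 by simp
    also have "\<dots> = x [^] k \<otimes> z \<otimes> x" unfolding z_def using x by (simp add: nat_pow_mult[symmetric])
    finally have "t \<oplus> b \<otimes> power_prod R (x # xs) ls = x [^] k \<otimes> (s \<oplus> (a \<oplus> b \<otimes> z \<otimes> ?p) \<otimes> x)"
      unfolding t ls(1) power_prod.simps list.sel using x a z p sc xk assms(2) by algebra
    moreover have "a \<oplus> b \<otimes> z \<otimes> ?p \<in> carrier R" using a z p assms(2) by simp
    ultimately show ?thesis unfolding ks(1) using leading_set_ConsI[OF s] by simp
  next
    case 2
    have "t \<oplus> b \<otimes> power_prod R (x # xs) ls = x [^] k \<otimes> ((s \<oplus> b \<otimes> ?p) \<oplus> a \<otimes> x)"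
      unfolding t ls(1) power_prod.simps list.sel 2(1)[symmetric] using x a p sc xk assms(2) by algebra
    moreover have "s \<oplus> b \<otimes> ?p \<in> leading_set R c xs ks'"
      by (rule Cons.IH[OF xs ks(2) ls(2) 2(2) s])
    ultimately show ?thesis unfolding ks(1) using leading_set_ConsI[OF _ a] by simp
  qed
qed simp

lemma leading_set_add_finsum:
  assumes "finite G" "c \<in> carrier R" "\<And>ls. ls \<in> G \<Longrightarrow> b ls \<in> carrier R"
    and "set xs \<subseteq> carrier R" "length ks = length xs"
    and "\<And>ls. ls \<in> G \<Longrightarrow> length ls = length xs \<and> (ks, ls) \<in> lex less_than"
  shows "c \<otimes> power_prod R xs ks \<oplus> (\<Oplus>ls\<in>G. b ls \<otimes> power_prod R xs ls) \<in> leading_set R c xs ks"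
  using assms(1,3,6)
proof (induction G rule: finite_induct)
  case empty
  then show ?case
    using leading_term_in_leading_set[OF assms(2,4,5)] power_prod_closed[OF assms(4)] assms(2) by simp
next
  case (insert g G)
  let ?p = "power_prod R xs" and ?t = "\<Oplus>ls\<in>G. b ls \<otimes> power_prod R xs ls"
  have p: "?p ls \<in> carrier R" for ls by (rule power_prod_closed[OF assms(4)])
  have b: "b g \<in> carrier R" "\<And>ls. ls \<in> G \<Longrightarrow> b ls \<in> carrier R" using insert.prems by auto
  then have tc: "?t \<in> carrier R" using p by (intro finsum_closed) auto
  have "(\<Oplus>ls\<in>insert g G. b ls \<otimes> ?p ls) = b g \<otimes> ?p g \<oplus> ?t"
    using insert.hyps b p by (intro finsum_insert) auto
  then have "c \<otimes> ?p ks \<oplus> (\<Oplus>ls\<in>insert g G. b ls \<otimes> ?p ls) = (c \<otimes> ?p ks \<oplus> ?t) \<oplus> b g \<otimes> ?p g"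
    using tc p b assms(2) by (simp add: a_ac)
  moreover have "c \<otimes> ?p ks \<oplus> ?t \<in> leading_set R c xs ks" using insert by auto
  ultimately show ?case
    using leading_set_add_greater[OF assms(2) b(1) assms(4,5)] insert.prems(2)[of g] by simp
qed

end

section \<open>Degrees\<close>

text \<open>Bounding the degree in each variable separately makes the count an n-th power, while the
  bound stays additive under products.\<close>

definition monomial_box :: "nat \<Rightarrow> nat \<Rightarrow> nat multiset set" where
  "monomial_box n d = {m. set_mset m \<subseteq> {Suc 0..n} \<and> (\<forall>i. count m i \<le> d)}"

lemma monomial_box_mono: "d \<le> e \<Longrightarrow> monomial_box n d \<subseteq> monomial_box n e"
  by (auto simp: monomial_box_def intro: le_trans)

lemma monomial_box_add:
  assumes "k \<in> monomial_box n d" "l \<in> monomial_box n e"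
  shows "k + l \<in> monomial_box n (d + e)"
  using assms by (auto simp: monomial_box_def intro: add_mono)

lemma
  shows finite_monomial_box: "finite (monomial_box n d)"
    and card_monomial_box: "card (monomial_box n d) \<le> Suc d ^ n"
proof -
  let ?f = "\<lambda>m. restrict (count m) {Suc 0..n}" and ?P = "PiE {Suc 0..n} (\<lambda>_. {..d})"
  have inj: "inj_on ?f (monomial_box n d)"
  proof (rule inj_onI)
    fix k l assume k: "k \<in> monomial_box n d" and l: "l \<in> monomial_box n d" and e: "?f k = ?f l"
    show "k = l"
    proof (rule multiset_eqI)
      fix i show "count k i = count l i"
      proof (cases "i \<in> {Suc 0..n}")
        case True
        then show ?thesis using fun_cong[OF e, of i] by simp
      next
        case False
        then have "i \<notin># k" "i \<notin># l" using k l by (auto simp: monomial_box_def)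
        then show ?thesis by (simp add: not_in_iff)
      qed
    qed
  qed
  have sub: "?f ` monomial_box n d \<subseteq> ?P" by (auto simp: monomial_box_def)
  have fin: "finite ?P" by (intro finite_PiE) auto
  show "finite (monomial_box n d)" using inj_on_finite[OF inj sub fin] .
  have "card (monomial_box n d) \<le> card ?P" using card_inj_on_le[OF inj sub fin] .
  also have "card ?P = Suc d ^ n" by (simp add: card_PiE)
  finally show "card (monomial_box n d) \<le> Suc d ^ n" .
qed

context cring
begin

definition deg_le :: "nat \<Rightarrow> nat \<Rightarrow> (nat multiset \<Rightarrow> 'a) \<Rightarrow> bool" where
  "deg_le n d p \<longleftrightarrow> (\<forall>m. p m \<noteq> \<zero> \<longrightarrow> m \<in> monomial_box n d)"

lemma deg_le_mono: "deg_le n d p \<Longrightarrow> d \<le> e \<Longrightarrow> deg_le n e p"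
  using monomial_box_mono unfolding deg_le_def by blast

lemma deg_le_const: "deg_le n 0 (indexed_const a)"
  by (auto simp: deg_le_def indexed_const_def monomial_box_def)

lemma mpolys_deg_le: "p \<in> mpolys n \<Longrightarrow> \<exists>d. deg_le n d p"
proof (induction rule: indexed_pset.induct)
  case (indexed_const k)
  then show ?case using deg_le_const by blast
next
  case (indexed_padd p q)
  then obtain d e where "deg_le n d p" "deg_le n e q" by blast
  then have pq: "deg_le n (max d e) p" "deg_le n (max d e) q" by (auto intro: deg_le_mono)
  have "p m \<noteq> \<zero> \<or> q m \<noteq> \<zero>" if "p m \<oplus> q m \<noteq> \<zero>" for m using that by auto
  then have "deg_le n (max d e) (indexed_padd p q)"
    using pq unfolding deg_le_def indexed_padd_def by blast
  then show ?case by blast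
next
  case (indexed_pmult p i)
  then obtain d where d: "deg_le n d p" by blast
  have "deg_le n (d + 1) (indexed_pmult p i)"
    unfolding deg_le_def
  proof (intro allI impI)
    fix m assume "indexed_pmult p i m \<noteq> \<zero>"
    then have i: "i \<in># m" and "p (m - {#i#}) \<noteq> \<zero>" by (auto simp: indexed_pmult_def split: if_splits)
    then have "m - {#i#} \<in> monomial_box n d" using d by (simp add: deg_le_def)
    moreover have "{#i#} \<in> monomial_box n 1"
      using indexed_pmult(2) by (auto simp: monomial_box_def)
    ultimately have "m - {#i#} + {#i#} \<in> monomial_box n (d + 1)" by (rule monomial_box_add)
    then show "m \<in> monomial_box n (d + 1)" using i by simp
  qed
  then show ?case by blast
qed

lemma deg_le_cauchy:
  assumes "deg_le n d p" "deg_le n e q" "p \<in> mpolys n" "q \<in> mpolys n"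
  shows "deg_le n (d + e) (cauchy p q)"
  unfolding deg_le_def
proof (intro allI impI)
  fix m assume nz: "cauchy p q m \<noteq> \<zero>"
  have c: "p k \<in> carrier R" "q k \<in> carrier R" for k
    using carrier_coeffE mpolys_coeff assms(3,4) by blast+
  obtain k where k: "k \<subseteq># m" "p k \<otimes> q (m - k) \<noteq> \<zero>"
    using nz add.finprod_one_eqI[of "{k. k \<subseteq># m}" "\<lambda>k. p k \<otimes> q (m - k)"] unfolding cauchy_def by auto
  then have "p k \<noteq> \<zero>" "q (m - k) \<noteq> \<zero>" using c by auto
  then have "k + (m - k) \<in> monomial_box n (d + e)"
    using assms(1,2) by (intro monomial_box_add) (auto simp: deg_le_def)
  then show "m \<in> monomial_box n (d + e)" using k(1) by simp
qed

lemma deg_le_power_prod: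
  assumes "set xs \<subseteq> mpolys n" "\<And>x. x \<in> set xs \<Longrightarrow> deg_le n d x" "set ks \<subseteq> {..b}" "length ks = length xs"
  shows "deg_le n (length xs * (b * d)) (power_prod (mpoly_ring R n) xs ks)"
  using assms
proof (induction xs arbitrary: ks)
  case Nil
  then show ?case by (simp add: deg_le_const)
next
  case (Cons x xs)
  interpret S: cring "mpoly_ring R n" by (rule mpoly_cring)
  from Cons.prems obtain k ks' where ks: "ks = k # ks'" "length ks' = length xs" by (cases ks) auto
  have x: "x \<in> mpolys n" and xc: "x \<in> carrier (mpoly_ring R n)" using Cons.prems by auto
  have pow: "x [^]\<^bsub>mpoly_ring R n\<^esub> j \<in> mpolys n" for j :: nat
    using S.nat_pow_closed[OF xc, of j] by simp
  have "deg_le n (j * d) (x [^]\<^bsub>mpoly_ring R n\<^esub> j)" for j :: nat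
  proof (induction j)
    case 0
    then show ?case by (simp add: deg_le_const)
  next
    case (Suc j)
    have "deg_le n (j * d + d) (cauchy (x [^]\<^bsub>mpoly_ring R n\<^esub> j) x)"
      using Cons.prems by (intro deg_le_cauchy Suc.IH pow x) auto
    then show ?case by (simp add: add.commute)
  qed
  moreover have "k \<le> b" using Cons.prems ks by auto
  ultimately have "deg_le n (b * d) (x [^]\<^bsub>mpoly_ring R n\<^esub> k)"
    using deg_le_mono by (meson mult_le_mono1)
  moreover have "deg_le n (length xs * (b * d)) (power_prod (mpoly_ring R n) xs ks')"
    using Cons.prems ks by (intro Cons.IH) auto
  moreover have "power_prod (mpoly_ring R n) xs ks' \<in> mpolys n"
    using S.power_prod_closed[of xs ks'] Cons.prems by simp
  ultimately have "deg_le n (b * d + length xs * (b * d))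
      (cauchy (x [^]\<^bsub>mpoly_ring R n\<^esub> k) (power_prod (mpoly_ring R n) xs ks'))"
    using pow by (intro deg_le_cauchy)
  then show ?case using ks by simp
qed

text \<open>A polynomial is a finite sum of monomials, and a monomial with coefficient in
  \<open>I\<close> is an element of \<open>J\<close> times variables. This turns a relation known
  coefficientwise modulo an ideal of \<open>R\<close> into membership in an ideal of the polynomial
  ring.\<close>

lemma mpoly_in_ideal_of_coeffs:
  assumes J: "ideal J (mpoly_ring R n)" and "\<zero> \<in> I" "indexed_const ` I \<subseteq> J"
    and p: "p \<in> mpolys n" "\<And>m. p m \<in> I"
  shows "p \<in> J"
proof -
  interpret S: cring "mpoly_ring R n" by (rule mpoly_cring)
  interpret J: ideal J "mpoly_ring R n" by (rule J)
  have I: "I \<subseteq> carrier R"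
  proof
    fix a assume "a \<in> I"
    then have "indexed_const a \<in> mpolys n" using assms(3) J.Icarr by auto
    then have "(indexed_const a :: nat multiset \<Rightarrow> 'a) {#} \<in> carrier R"
      using carrier_coeffE mpolys_coeff by blast
    then show "a \<in> carrier R" by (simp add: indexed_const_def)
  qed
  have mono: "(\<lambda>l. if l = m then a else \<zero>) \<in> J" if "a \<in> I" "set_mset m \<subseteq> {Suc 0..n}" for m a
    using that(2)
  proof (induction m)
    case empty
    have "(\<lambda>l. if l = {#} then a else \<zero>) = indexed_const a" by (simp add: indexed_const_def)
    then show ?case using assms(3) that(1) by auto
  next
    case (add i m)
    let ?q = "\<lambda>l. if l = m then a else \<zero>"
    have q: "?q \<in> J" using add by simp
    then have qc: "?q \<in> mpolys n" using J.Icarr by auto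
    have i: "indexed_var i \<in> carrier (mpoly_ring R n)" using add.prems indexed_var_mpolys[of i n] by simp
    have "cauchy (indexed_var i) ?q \<in> J" using J.I_l_closed[OF q i] by simp
    moreover have "cauchy (indexed_var i) ?q = (\<lambda>l. if l = add_mset i m then a else \<zero>)"
      unfolding cauchy_indexed_var[OF qc] indexed_pmult_def by (auto simp: fun_eq_iff dest: insert_DiffM)
    ultimately show ?case by simp
  qed
  \<comment> \<open>Induction on a finite set that contains the support: one coefficient at a time
    is cleared, and 0 is an allowed coefficient.\<close>
  have "q \<in> J" if "finite M" "\<And>m. m \<in> M \<Longrightarrow> set_mset m \<subseteq> {Suc 0..n}" "\<And>m. m \<notin> M \<Longrightarrow> q m = \<zero>" "\<And>m. q m \<in> I"
    for M and q :: "nat multiset \<Rightarrow> 'a"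
    using that
  proof (induction M arbitrary: q rule: finite_induct)
    case empty
    then have "q = \<zero>\<^bsub>mpoly_ring R n\<^esub>" by (auto simp: indexed_const_def)
    then show ?case using J.zero_closed by metis
  next
    case (insert m M)
    have "q(m := \<zero>) \<in> J" using insert.prems assms(2) by (intro insert.IH) auto
    moreover have "(\<lambda>l. if l = m then q m else \<zero>) \<in> J" using insert.prems by (intro mono) auto
    ultimately have "indexed_padd (q(m := \<zero>)) (\<lambda>l. if l = m then q m else \<zero>) \<in> J"
      using J.a_closed by simp
    moreover have "q l \<in> carrier R" for l using insert.prems(3) I by blast
    then have "indexed_padd (q(m := \<zero>)) (\<lambda>l. if l = m then q m else \<zero>) = q"
      by (auto simp: indexed_padd_def)
    ultimately show ?case by simp
  qed
  moreover obtain d where "deg_le n d p" using mpolys_deg_le[OF p(1)] by blast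
  ultimately show ?thesis
    using p(2) finite_monomial_box[of n d] unfolding deg_le_def monomial_box_def by blast
qed

lemma mpoly_finsum_coeff:
  assumes "finite E" "\<And>e. e \<in> E \<Longrightarrow> g e \<in> mpolys n"
  shows "(\<Oplus>\<^bsub>mpoly_ring R n\<^esub>e\<in>E. g e) m = (\<Oplus>e\<in>E. g e m)"
  using assms
proof (induction E rule: finite_induct)
  case empty
  interpret S: cring "mpoly_ring R n" by (rule mpoly_cring)
  show ?case by (simp add: indexed_const_def)
next
  case (insert e E)
  interpret S: cring "mpoly_ring R n" by (rule mpoly_cring)
  have c: "g e \<in> carrier (mpoly_ring R n)" "g \<in> E \<rightarrow> carrier (mpoly_ring R n)"
    using insert.prems by auto
  have cm: "g e m \<in> carrier R" "(\<lambda>e. g e m) \<in> E \<rightarrow> carrier R"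
    using insert.prems carrier_coeffE[OF mpolys_coeff] by auto
  have "(\<Oplus>\<^bsub>mpoly_ring R n\<^esub>e\<in>insert e E. g e) = g e \<oplus>\<^bsub>mpoly_ring R n\<^esub> (\<Oplus>\<^bsub>mpoly_ring R n\<^esub>e\<in>E. g e)"
    by (rule S.finsum_insert[OF insert.hyps c(2,1)])
  then have "(\<Oplus>\<^bsub>mpoly_ring R n\<^esub>e\<in>insert e E. g e) m = g e m \<oplus> (\<Oplus>\<^bsub>mpoly_ring R n\<^esub>e\<in>E. g e) m"
    by (simp add: indexed_padd_def)
  also have "\<dots> = (\<Oplus>e\<in>insert e E. g e m)"
    using insert cm by (simp add: finsum_insert)
  finally show ?case .
qed

end

section \<open>The relative dimension of a polynomial ring\<close>

text \<open>The right-hand side counts the exponent vectors with entries below \<open>D\<close>, the left-hand side bounds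
  the number of monomials in the corresponding products of \<open>n + 1\<close> polynomials of degree at most \<open>d\<close>
  in each of the \<open>n\<close> variables.\<close>

lemma monomial_count_less:
  fixes n d :: nat
  assumes "d > 0"
  defines "D \<equiv> (Suc n * d) ^ n + 1"
  shows "Suc (Suc n * ((D - 1) * d)) ^ n < D ^ Suc n"
proof -
  \<comment> \<open>The additional 1 is absorbed since (n + 1) d is at least 1. After taking n-th
    powers, the choice of D as one more than ((n + 1) d)^n gives the strict inequality.\<close>
  have "Suc (Suc n * ((D - 1) * d)) \<le> Suc n * d * D"
  proof -
    have "D = Suc (D - 1)" by (simp add: D_def)
    then have "Suc n * d * D = Suc n * d + Suc n * ((D - 1) * d)"
      by (metis mult.assoc mult.commute mult_Suc_right)
    moreover have "Suc n * d \<ge> 1" using assms(1) by simp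
    ultimately show ?thesis by linarith
  qed
  then have "Suc (Suc n * ((D - 1) * d)) ^ n \<le> (Suc n * d * D) ^ n" by (rule power_mono) simp
  also have "\<dots> = (Suc n * d) ^ n * D ^ n" by (rule power_mult_distrib)
  also have "\<dots> < D * D ^ n" unfolding D_def by (intro mult_strict_right_mono) auto
  finally show ?thesis by simp
qed

context cring
begin

text \<open>The unknowns are the coefficients \<open>c ks\<close>, with one equation for each
  monomial of a box. \<open>E\<close> and \<open>F\<close> come before \<open>H\<close>, since the
  adjoined family must not depend on the partition.\<close>

lemma algebraic_relation:
  assumes "set xs \<subseteq> mpolys n" "length xs = Suc n"
  obtains E F where "finite E" "\<And>ks. ks \<in> E \<Longrightarrow> length ks = Suc n" "finite F" "F \<subseteq> carrier R"
    "\<And>H. H \<subseteq> F \<Longrightarrow> \<exists>c. (\<forall>ks\<in>E. c ks \<in> F) \<and> (\<exists>ks\<in>E. c ks \<in> monoid_generated R (F - H)) \<and>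
      (\<forall>m. (\<Oplus>ks\<in>E. c ks \<otimes> power_prod (mpoly_ring R n) xs ks m) \<in> Idl H)"
proof -
  let ?S = "mpoly_ring R n"
  interpret S: cring ?S by (rule mpoly_cring)
  have "\<exists>d. \<forall>x\<in>set xs. deg_le n d x"
    using assms(1)
  proof (induction xs)
    case (Cons x xs)
    then obtain d where "\<forall>x\<in>set xs. deg_le n d x" by auto
    moreover obtain e where "deg_le n e x" using mpolys_deg_le[of x n] Cons.prems by auto
    ultimately have "\<forall>y\<in>set (x # xs). deg_le n (max d e) y" by (auto intro: deg_le_mono)
    then show ?case by blast
  qed simp
  then obtain d0 where d0: "\<forall>x\<in>set xs. deg_le n d0 x" by blast
  \<comment> \<open>The successor makes the degree bound positive, as
    \<open>monomial_count_less\<close> requires.\<close>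
  define d where "d = Suc d0"
  have d: "deg_le n d x" if "x \<in> set xs" for x
    using d0 that deg_le_mono[of n d0 x d] by (simp add: d_def)
  define D where "D = (Suc n * d) ^ n + 1"
  define E where "E = {ks. set ks \<subseteq> {..D - 1} \<and> length ks = Suc n}"
  define I where "I = monomial_box n (Suc n * ((D - 1) * d))"
  have E: "finite E" unfolding E_def by (rule finite_lists_length_eq) simp
  have "card E = D ^ Suc n" unfolding E_def by (subst card_lists_length_eq) (simp_all add: D_def)
  moreover have "card I \<le> Suc (Suc n * ((D - 1) * d)) ^ n" unfolding I_def by (rule card_monomial_box)
  moreover have "Suc (Suc n * ((D - 1) * d)) ^ n < D ^ Suc n"
    unfolding D_def by (rule monomial_count_less) (simp add: d_def)
  ultimately have card: "card I < card E" by simp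
  let ?v = "\<lambda>ks m. power_prod ?S xs ks m"
  have pp: "power_prod ?S xs ks \<in> mpolys n" for ks
    using S.power_prod_closed[of xs ks] assms(1) by simp
  have v: "?v ks m \<in> carrier R" for ks m
    using carrier_coeffE[OF mpolys_coeff[OF pp]] .
  have I: "finite I" unfolding I_def by (rule finite_monomial_box)
  obtain F where F: "finite F" "F \<subseteq> carrier R"
    and sol: "\<forall>H\<subseteq>F. \<exists>c. (\<forall>ks\<in>E. c ks \<in> F) \<and> (\<exists>ks\<in>E. c ks \<in> monoid_generated R (F - H)) \<and>
      (\<forall>m\<in>I. (\<Oplus>ks\<in>E. c ks \<otimes> ?v ks m) \<in> Idl H)"
    using homogeneous_system_solution[OF I E card, of ?v, OF v] by (elim exE conjE)
  show ?thesis
  proof (rule that[OF E _ F])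
    show "length ks = Suc n" if "ks \<in> E" for ks using that by (simp add: E_def)
    fix H assume H: "H \<subseteq> F"
    then obtain c where c: "\<forall>ks\<in>E. c ks \<in> F" "\<exists>ks\<in>E. c ks \<in> monoid_generated R (F - H)"
      "\<forall>m\<in>I. (\<Oplus>ks\<in>E. c ks \<otimes> ?v ks m) \<in> Idl H"
      using sol[rule_format, OF H] by (elim exE conjE)
    interpret Idl: ideal "Idl H" R using H F(2) by (intro genideal_ideal) blast
    \<comment> \<open>Outside the box every product has coefficient 0, so the finitely many
      equations account for all monomials.\<close>
    have "(\<Oplus>ks\<in>E. c ks \<otimes> ?v ks m) \<in> Idl H" for m
    proof (cases "m \<in> I")
      case False
      have "?v ks m = \<zero>" if "ks \<in> E" for ks
      proof -
        have "deg_le n (length xs * ((D - 1) * d)) (power_prod ?S xs ks)"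
          using that assms d by (intro deg_le_power_prod) (auto simp: E_def)
        then show ?thesis using False assms(2) unfolding deg_le_def I_def by auto
      qed
      then have "(\<Oplus>ks\<in>E. c ks \<otimes> ?v ks m) = \<zero>"
        using c(1) F(2) by (intro add.finprod_one_eqI) auto
      then show ?thesis by simp
    qed (use c(3) in blast)
    then show "\<exists>c. (\<forall>ks\<in>E. c ks \<in> F) \<and> (\<exists>ks\<in>E. c ks \<in> monoid_generated R (F - H)) \<and>
        (\<forall>m. (\<Oplus>ks\<in>E. c ks \<otimes> ?v ks m) \<in> Idl H)"
      using c(1,2) by blast
  qed
qed

section \<open>Upper bound for the relative dimension\<close>

lemma indexed_const_monoid_generated:
  "a \<in> monoid_generated R U \<Longrightarrow> U \<subseteq> carrier R \<Longrightarrow>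
    indexed_const a \<in> monoid_generated (mpoly_ring R n) (indexed_const ` U)"
proof (induction rule: monoid_generated.induct)
  case one
  show ?case using monoid_generated.one[of "mpoly_ring R n"] by simp
next
  case (incl u)
  then show ?case by (intro monoid_generated.incl) auto
next
  case (prod u v)
  have "u \<in> carrier R" "v \<in> carrier R" using prod monoid_generated_closed by blast+
  then have "indexed_const (u \<otimes> v) = indexed_const u \<otimes>\<^bsub>mpoly_ring R n\<^esub> indexed_const v"
    by (rule ring_hom_mult[OF indexed_const_ring_hom])
  then show ?case using monoid_generated.prod[OF prod.IH(1)[OF prod.prems] prod.IH(2)[OF prod.prems]] by simp
qed

lemma rel_krull_dim_le_mpoly_ring: "rel_krull_dim_le (mpoly_ring R n) (mpoly_consts R) (int n)"
proof -
  let ?S = "mpoly_ring R n"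
  interpret S: cring ?S by (rule mpoly_cring)
  have "collapses_above ?S (mpoly_consts R) (elementary_chain ?S xs)"
    if xs: "set xs \<subseteq> carrier ?S" and len: "length xs = Suc n" for xs
  proof -
    let ?p = "power_prod ?S xs"
    have p: "?p ks \<in> carrier ?S" for ks by (rule S.power_prod_closed[OF xs])
    obtain E F where E: "finite E" "\<And>ks. ks \<in> E \<Longrightarrow> length ks = Suc n"
      and F: "finite F" "F \<subseteq> carrier R"
      and rel: "\<And>H. H \<subseteq> F \<Longrightarrow> \<exists>c. (\<forall>ks\<in>E. c ks \<in> F) \<and> (\<exists>ks\<in>E. c ks \<in> monoid_generated R (F - H)) \<and>
      (\<forall>m. (\<Oplus>ks\<in>E. c ks \<otimes> ?p ks m) \<in> Idl H)"
      using algebraic_relation[of xs n] xs len by auto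
    obtain fs where fs: "set fs = F" using finite_list[OF F(1)] by blast
    have const: "indexed_const a \<in> carrier ?S" if "a \<in> carrier R" for a
      using that by (rule ring_hom_closed[OF indexed_const_ring_hom])
    have "collapses ?S (adjoin_last ((!) (map indexed_const fs) ` H')
        (adjoin_first ((!) (map indexed_const fs) ` H) (elementary_chain ?S xs)))"
      if HH: "H \<union> H' = {..<length (map indexed_const fs)}" for H H'
    proof -
      define A where "A = (!) fs ` H"
      define V where "V = (!) fs ` H'"
      \<comment> \<open>The list \<open>fs\<close> may repeat values, so \<open>A\<close> and
        \<open>V\<close> may overlap; the argument rests on their union being
        \<open>F\<close>.\<close>
      have AV: "A \<union> V = F"
        using HH fs unfolding A_def V_def image_Un[symmetric] by (auto simp: set_conv_nth)
      have "(!) (map indexed_const fs) ` L = indexed_const ` (!) fs ` L" if "L \<subseteq> {..<length fs}" for L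
        unfolding image_image by (rule image_cong) (use that in auto)
      moreover have "H \<subseteq> {..<length fs}" "H' \<subseteq> {..<length fs}" using HH by auto
      ultimately have img: "(!) (map indexed_const fs) ` H = indexed_const ` A"
        "(!) (map indexed_const fs) ` H' = indexed_const ` V"
        unfolding A_def V_def by blast+
      have A: "A \<subseteq> carrier R" and V: "V \<subseteq> carrier R" using AV F(2) by auto
      have AS: "indexed_const ` A \<subseteq> carrier ?S" and VS: "indexed_const ` V \<subseteq> carrier ?S"
        using A V const by blast+
      let ?M = "monoid_generated ?S (insert \<one>\<^bsub>?S\<^esub> (indexed_const ` V))"
      let ?J = "Idl\<^bsub>?S\<^esub> (indexed_const ` A \<union> {\<zero>\<^bsub>?S\<^esub>})"
      have A0S: "indexed_const ` A \<union> {\<zero>\<^bsub>?S\<^esub>} \<subseteq> carrier ?S" using AS S.zero_closed by blast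
      have J: "ideal ?J ?S" by (rule S.genideal_ideal[OF A0S])
      interpret J: ideal ?J ?S by (rule J)
      obtain c where c: "\<forall>ks\<in>E. c ks \<in> F" "\<exists>ks\<in>E. c ks \<in> monoid_generated R (F - A)"
        "\<forall>m. (\<Oplus>ks\<in>E. c ks \<otimes> ?p ks m) \<in> Idl A"
        using rel[of A] AV by auto
      have cR: "c ks \<in> carrier R" if "ks \<in> E" for ks using c(1) F(2) that by blast
      have "monoid_generated R (F - A) \<subseteq> monoid_generated R V"
        using AV by (intro monoid_generated_mono) blast
      then have "{ks \<in> E. c ks \<in> monoid_generated R V} \<noteq> {}" using c(2) by blast
      \<comment> \<open>The leading exponent. By minimality the coefficients at smaller exponents
        are outside \<open>V\<close>; as members of \<open>F\<close> they then lie in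
        \<open>A\<close>.\<close>
      then obtain k0 where k0: "k0 \<in> E" "c k0 \<in> monoid_generated R V"
        and min: "\<And>ks. (ks, k0) \<in> lex less_than \<Longrightarrow> ks \<in> E \<Longrightarrow> c ks \<notin> monoid_generated R V"
        using wf_eq_minimal[THEN iffD1, OF wf_lex[OF wf_less_than], rule_format, of _ "{ks \<in> E. c ks \<in> monoid_generated R V}"]
        by blast
      let ?b = "\<lambda>ks. indexed_const (c ks)"
      let ?f = "\<lambda>ks. ?b ks \<otimes>\<^bsub>?S\<^esub> ?p ks"
      have b: "?b ks \<in> carrier ?S" if "ks \<in> E" for ks using cR[OF that] const by blast
      have f: "?f ks \<in> carrier ?S" if "ks \<in> E" for ks using b[OF that] p by (rule S.m_closed)
      define L where "L = lex less_than"
      define E0 where "E0 = {ks \<in> E. (ks, k0) \<in> L}"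
      \<comment> \<open>Removing \<open>E0\<close> yields disjointness without an appeal to
        asymmetry of the order.\<close>
      define E1 where "E1 = {ks \<in> E. (k0, ks) \<in> L} - E0"
      have irr: "(k0, k0) \<notin> L" unfolding L_def using wf_lex[OF wf_less_than] by (rule wf_not_refl)
      have "ks = k0 \<or> (ks, k0) \<in> L \<or> (k0, ks) \<in> L" if "ks \<in> E" for ks
        unfolding L_def using lex_less_than_linear[of ks k0] E(2)[OF that] E(2)[OF k0(1)] by argo
      then have split: "E = insert k0 E1 \<union> E0" "k0 \<notin> E1" "insert k0 E1 \<inter> E0 = {}"
        using k0(1) irr unfolding E0_def E1_def by auto
      have fin: "finite E0" "finite E1" "finite (insert k0 E1)" using E(1) by (simp_all add: E0_def E1_def)
      have sub: "E0 \<subseteq> E" "E1 \<subseteq> E" "insert k0 E1 \<subseteq> E" using k0(1) by (auto simp: E0_def E1_def)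
      define t where "t = (\<Oplus>\<^bsub>?S\<^esub>ks\<in>insert k0 E1. ?f ks)"
      define j where "j = (\<Oplus>\<^bsub>?S\<^esub>ks\<in>E0. ?f ks)"
      define Q where "Q = (\<Oplus>\<^bsub>?S\<^esub>ks\<in>E. ?f ks)"
      have fPi: "?f \<in> G \<rightarrow> carrier ?S" if "G \<subseteq> E" for G using f that by blast
      have tc: "t \<in> carrier ?S" unfolding t_def by (rule S.finsum_closed[OF fPi[OF sub(3)]])
      have jc: "j \<in> carrier ?S" unfolding j_def by (rule S.finsum_closed[OF fPi[OF sub(1)]])
      have Qtj: "Q = t \<oplus>\<^bsub>?S\<^esub> j"
        unfolding Q_def t_def j_def
        by (subst split(1), rule S.finsum_Un_disjoint[OF fin(3,1) split(3) fPi[OF sub(3)] fPi[OF sub(1)]])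
      have "t = ?b k0 \<otimes>\<^bsub>?S\<^esub> ?p k0 \<oplus>\<^bsub>?S\<^esub> (\<Oplus>\<^bsub>?S\<^esub>ks\<in>E1. ?f ks)"
        unfolding t_def by (rule S.finsum_insert[OF fin(2) split(2) fPi[OF sub(2)] f[OF k0(1)]])
      also have "\<dots> \<in> leading_set ?S (?b k0) xs k0"
      proof (rule S.leading_set_add_finsum[OF fin(2) b[OF k0(1)] _ xs])
        show "?b ks \<in> carrier ?S" if "ks \<in> E1" for ks using b sub(2) that by blast
        show "length k0 = length xs" using E(2)[OF k0(1)] len by simp
        show "length ks = length xs \<and> (k0, ks) \<in> lex less_than" if "ks \<in> E1" for ks
          using that E(2)[of ks] len by (simp add: E1_def L_def)
      qed
      also have "leading_set ?S (?b k0) xs k0 \<subseteq> boundary_set ?S ?M xs"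
      proof (rule S.leading_set_subset_boundary_set)
        have "?b k0 \<in> monoid_generated ?S (indexed_const ` V)"
          by (rule indexed_const_monoid_generated[OF k0(2) V])
        then show "?b k0 \<in> ?M" using S.monoid_generated_mono[of "indexed_const ` V"] by blast
      qed
      finally have t: "t \<in> boundary_set ?S ?M xs" .
      have A_J: "indexed_const a \<in> ?J" if "a \<in> A" for a
        using S.genideal_self[OF A0S] that by blast
      have "j \<in> ?J"
        unfolding j_def
      proof (rule S.finsum_ideal[OF J])
        fix ks assume ks: "ks \<in> E0"
        then have "c ks \<notin> V" using min[of ks] monoid_generated.incl[of "c ks" V] unfolding E0_def L_def by blast
        then have "c ks \<in> A" using c(1) ks sub(1) AV by blast
        then show "?f ks \<in> ?J" using A_J J.I_r_closed p by blast
      qed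
      \<comment> \<open>The relation need not be 0 in the polynomial ring: its coefficients are only
        known to lie in \<open>Idl A\<close>, so \<open>Q\<close> has to be subtracted in the
        end.\<close>
      have "Q \<in> ?J"
      proof (rule mpoly_in_ideal_of_coeffs[OF J, of "Idl A"])
        interpret I: ideal "Idl A" R by (rule genideal_ideal[OF A])
        show "\<zero> \<in> Idl A" by (rule I.zero_closed)
        show "Q \<in> mpolys n" using Qtj tc jc S.a_closed by auto
        show "indexed_const ` (Idl A) \<subseteq> ?J"
        proof -
          have "ring_hom_ring R ?S indexed_const"
            by (intro ring_hom_ringI2 ring_axioms S.ring_axioms indexed_const_ring_hom)
          then have "ideal {a \<in> carrier R. indexed_const a \<in> ?J} R"
            using ring_hom_ring.ideal_vimage[of R ?S indexed_const ?J] J by blast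
          from genideal_minimal[OF this, of A] show ?thesis using A A_J by blast
        qed
        show "Q m \<in> Idl A" for m
        proof -
          have "Q m = (\<Oplus>ks\<in>E. ?f ks m)"
            unfolding Q_def by (rule mpoly_finsum_coeff) (use E(1) f in auto)
          also have "\<dots> = (\<Oplus>ks\<in>E. c ks \<otimes> ?p ks m)"
          proof (rule finsum_cong')
            have pc: "carrier_coeff (?p ks)" for ks using p[of ks] mpolys_coeff by auto
            then show "(\<lambda>ks. c ks \<otimes> ?p ks m) \<in> E \<rightarrow> carrier R"
              using cR carrier_coeffE by blast
            show "?f ks m = c ks \<otimes> ?p ks m" if "ks \<in> E" for ks
              using cauchy_indexed_const[OF cR[OF that] pc, of ks] by simp
          qed simp
          finally show ?thesis using c(3) by simp
        qed
      qed
      \<comment> \<open>The ideal element that completes the collapse is j - Q, because Q = t +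
        j.\<close>
      have "j \<oplus>\<^bsub>?S\<^esub> \<ominus>\<^bsub>?S\<^esub> Q \<in> ?J"
        by (rule J.a_closed[OF \<open>j \<in> ?J\<close> J.a_inv_closed[OF \<open>Q \<in> ?J\<close>]])
      moreover have "t \<oplus>\<^bsub>?S\<^esub> (j \<oplus>\<^bsub>?S\<^esub> \<ominus>\<^bsub>?S\<^esub> Q) = \<zero>\<^bsub>?S\<^esub>"
        unfolding Qtj S.a_assoc[OF tc jc S.a_inv_closed[OF S.a_closed[OF tc jc]], symmetric]
        by (rule S.r_neg[OF S.a_closed[OF tc jc]])
      ultimately show ?thesis
        unfolding img S.collapses_adjoined_elementary_iff[OF AS VS xs] using t by blast
    qed
    moreover have "set (map indexed_const fs) \<subseteq> mpoly_consts R"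
      using fs F(2) by (auto simp: mpoly_consts_def)
    ultimately show ?thesis
      unfolding collapses_above_def by (intro exI[of _ "map indexed_const fs"]) blast
  qed
  then show ?thesis unfolding rel_krull_dim_le_def by simp
qed

end

text \<open>The upper bound on the relative dimension is asserted for every \<open>R\<close>;
  equality presupposes 1 \<noteq> 0, because over the trivial ring no lower bound holds.\<close>

theorem proposition4p7:
  fixes R :: "('a, 'm) ring_scheme" and n :: nat
  assumes "cring R"
  shows "rel_krull_dim_le (mpoly_ring R n) (mpoly_consts R) (int n) \<and>
    (\<one>\<^bsub>R\<^esub> \<noteq> \<zero>\<^bsub>R\<^esub> \<longrightarrow> rel_krull_dim_eq (mpoly_ring R n) (mpoly_consts R) n) \<and>
    (\<forall>r::int. r \<ge> -1 \<longrightarrow>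
       (krull_dim_le R r \<longrightarrow> krull_dim_le (mpoly_ring R n) (r + int n + r * int n)) \<and>
       (krull_dim_le (mpoly_ring R n) (r + int n) \<longrightarrow> krull_dim_le R r))"
proof -
  interpret R: cring R by (rule assms)
  note rel = R.rel_krull_dim_le_mpoly_ring[of n]
  have "rel_krull_dim_eq (mpoly_ring R n) (mpoly_consts R) n" if "\<one>\<^bsub>R\<^esub> \<noteq> \<zero>\<^bsub>R\<^esub>"
    unfolding rel_krull_dim_eq_def using rel R.rel_krull_dim_ge_mpoly_ring[OF that] by blast
  moreover have "krull_dim_le (mpoly_ring R n) (r + int n + r * int n)" if "krull_dim_le R r" for r
    using ring_hom_cring.krull_dim_le_of_relative[OF R.mpoly_ring_hom_cring _ that] rel
    unfolding mpoly_consts_def by blast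
  ultimately show ?thesis using rel R.krull_dim_le_of_mpoly_ring[of _ n] by blast
qed

end
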